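(* There exist $v_0\in X^1_{\rm per}$ with $v_0\neq 0$ and a constant $C>0$ such that the unique global solution $v\in C(\mathbb{R},X^1_{\rm per})$ of the Cauchy problem $$v_t+\tfrac16\,\partial_z\big[(z^2-\pi^2)v\big]=\partial_z^{-1}v,\quad t>0,\qquad v|_{t=0}=v_0,$$ satisfies the lower bound $$\|v(t)\|_{L^2_{\rm per}}\ \ge\ C\,\|v_0\|_{L^2_{\rm per}}\,e^{\pi t/6},\qquad t>0.$$
   Context: $L^2_{\rm per}$ and $H^1_{\rm per}$ are the spaces of $2\pi$-periodic $L^2$ and $H^1$ functions on $(-\pi,\pi)$, and $\dot L^2_{\rm per}$ is the subspace of zero-mean functions in $L^2_{\rm per}$. The function $\pi^2-z^2$ is defined on $[-\pi,\pi]$ and continued $2\pi$-periodically. $X^1_{\rm per}:=\{v\in\dot L^2_{\rm per}:\ \tfrac16(\pi^2-z^2)v\in H^1_{\rm per}\}$, with norm $\|v\|_{X^1_{\rm per}}=\|v\|_{L^2_{\rm per}}+\|\partial_z[\tfrac16(\pi^2-z^2)v]\|_{L^2_{\rm per}}$. The operator $\partial_z^{-1}$ maps a function in $\dot L^2_{\rm per}$ to its unique zero-mean $2\pi$-periodic antiderivative. A solution $v\in C(\mathbb{R},X^1_{\rm per})$ satisfies the equation in $\dot L^2_{\rm per}$; for every $v_0\in X^1_{\rm per}$ such a global solution exists and is unique. *)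

theory Defs
  imports "HOL-Analysis.Analysis" "HOL-Library.Periodic_Fun" "HOL-Library.Real_Mod"
begin

text \<open>
  Elements of the Lebesgue and Sobolev spaces are represented by Borel measurable real functions
  on the real line that are periodic with period \<open>2 * pi\<close>; two functions represent the same
  element iff they agree almost everywhere.
\<close>

definition L2_per :: "(real \<Rightarrow> real) set" where
  "L2_per = {f. f \<in> borel_measurable borel \<and> periodic_fun_simple f (2 * pi) \<and>
                set_integrable lborel {-pi..pi} (\<lambda>z. (f z)\<^sup>2)}"

definition L2_norm :: "(real \<Rightarrow> real) \<Rightarrow> real" where
  "L2_norm f = sqrt (LBINT z:{-pi..pi}. (f z)\<^sup>2)"

definition L2_dot_per :: "(real \<Rightarrow> real) set" where
  "L2_dot_per = {f \<in> L2_per. (LBINT z:{-pi..pi}. f z) = 0}"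

definition smooth_per :: "(real \<Rightarrow> real) \<Rightarrow> bool" where
  "smooth_per \<phi> \<longleftrightarrow> periodic_fun_simple \<phi> (2 * pi) \<and>
     (\<forall>n z. (deriv ^^ n) \<phi> differentiable (at z))"

text \<open>
  Weak derivatives are taken on the circle: the test functions are periodic and need not vanish
  at \<open>-pi\<close> and \<open>pi\<close>, so a jump across the end points of the period is excluded.
\<close>

definition has_weak_deriv_per :: "(real \<Rightarrow> real) \<Rightarrow> (real \<Rightarrow> real) \<Rightarrow> bool" where
  "has_weak_deriv_per f g \<longleftrightarrow>
     (\<forall>\<phi>. smooth_per \<phi> \<longrightarrow>
        (LBINT z:{-pi..pi}. f z * deriv \<phi> z) = - (LBINT z:{-pi..pi}. g z * \<phi> z))"

definition H1_per :: "(real \<Rightarrow> real) set" where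
  "H1_per = {f \<in> L2_per. \<exists>g \<in> L2_per. has_weak_deriv_per f g}"

text \<open>The weak derivative of an element of \<open>H1_per\<close>; it is determined up to a null set.\<close>

definition dz :: "(real \<Rightarrow> real) \<Rightarrow> (real \<Rightarrow> real)" where
  "dz f = (SOME g. g \<in> L2_per \<and> has_weak_deriv_per f g)"

text \<open>
  The zero-mean periodic antiderivative of \<open>v\<close> in \<open>L2_dot_per\<close>, as an (absolutely) continuous
  function; it is unique pointwise, not only almost everywhere.
\<close>

definition dz_inv :: "(real \<Rightarrow> real) \<Rightarrow> (real \<Rightarrow> real)" where
  "dz_inv v = (THE w. periodic_fun_simple w (2 * pi) \<and>
                      (\<forall>a b. a \<le> b \<longrightarrow> w b - w a = (LBINT z:{a..b}. v z)) \<and>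
                      (LBINT z:{-pi..pi}. w z) = 0)"

text \<open>The representative of \<open>z\<close> modulo \<open>2 * pi\<close> in the interval from \<open>-pi\<close> to \<open>pi\<close>.\<close>

definition zper :: "real \<Rightarrow> real" where
  "zper z = (z + pi) rmod (2 * pi) - pi"

definition X1_per :: "(real \<Rightarrow> real) set" where
  "X1_per = {v \<in> L2_dot_per. (\<lambda>z. 1/6 * (pi\<^sup>2 - (zper z)\<^sup>2) * v z) \<in> H1_per}"

definition X1_norm :: "(real \<Rightarrow> real) \<Rightarrow> real" where
  "X1_norm v = L2_norm v + L2_norm (dz (\<lambda>z. 1/6 * (pi\<^sup>2 - (zper z)\<^sup>2) * v z))"

definition continuous_X1 :: "(real \<Rightarrow> real \<Rightarrow> real) \<Rightarrow> bool" where
  "continuous_X1 v \<longleftrightarrow> (\<forall>t. v t \<in> X1_per) \<and>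
     (\<forall>t. ((\<lambda>s. X1_norm (\<lambda>z. v s z - v t z)) \<longlongrightarrow> 0) (at t))"

definition has_L2_time_deriv :: "(real \<Rightarrow> real \<Rightarrow> real) \<Rightarrow> (real \<Rightarrow> real) \<Rightarrow> real \<Rightarrow> bool" where
  "has_L2_time_deriv v u t \<longleftrightarrow> u \<in> L2_dot_per \<and>
     ((\<lambda>h. L2_norm (\<lambda>z. (v (t + h) z - v t z) / h - u z)) \<longlongrightarrow> 0) (at 0)"

definition is_global_solution :: "(real \<Rightarrow> real) \<Rightarrow> (real \<Rightarrow> real \<Rightarrow> real) \<Rightarrow> bool" where
  "is_global_solution v\<^sub>0 v \<longleftrightarrow> continuous_X1 v \<and>
     (\<forall>t. \<exists>v\<^sub>t. has_L2_time_deriv v v\<^sub>t t \<and>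
        (AE z in lborel. v\<^sub>t z + dz (\<lambda>y. 1/6 * ((zper y)\<^sup>2 - pi\<^sup>2) * v t y) z = dz_inv (v t) z)) \<and>
     (AE z in lborel. v 0 z = v\<^sub>0 z)"

end

theory Submission
  imports Defs "HOL-Complex_Analysis.Complex_Analysis"
begin

text \<open>
  Uniqueness is an energy estimate: the transport term contributes at most \<open>\<pi> / 3\<close> times the
  squared norm of a difference of solutions and the nonlocal term contributes nothing, so Gronwall's
  inequality applies in both time directions.

  For existence and growth an explicit solution suffices. In characteristic coordinates the equation
  for the antiderivative \<open>w\<close> of \<open>v\<close> becomes an Euler--Poisson--Darboux equation with integer
  parameter, whose solutions are elementary, and one of them is rational in \<open>z\<close> and \<open>exp (\<pi> t / 3)\<close>
  and vanishes at \<open>z = -\<pi>\<close> and \<open>z = \<pi>\<close>. It stays of order one at distance \<open>O(exp (- \<pi> t / 3))\<close>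
  from \<open>-\<pi>\<close>, and by the Cauchy--Schwarz inequality the norm of its derivative is at least of order
  \<open>exp (\<pi> t / 6)\<close>.
\<close>

subsection \<open>Integration on the real line\<close>

text \<open>The speed \<open>(z^2 - pi^2) / 6\<close> is negative inside the period and has slope
  \<open>- pi / 3\<close> at \<open>- pi\<close>, so the characteristics crowd there at the rate
  \<open>exp (- pi * t / 3)\<close>; both exponents come from this slope. If \<open>A\<close> is
  constant along characteristics and \<open>T\<close> is a multiple of
  \<open>exp (pi * t / 3)\<close>, the transport derivative becomes \<open>pi / 3 * T * d/dT\<close>
  and \<open>d/dz\<close> becomes \<open>(A + T)^2 / (2 * pi * T) * d/dA\<close>. The product of the
  two factors is \<open>(A + T)^2 / 6\<close>, and \<open>6 = 2 * 3\<close> is an integer case in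
  which solutions need only finitely many derivatives of a free function. The explicit solution is
  classical on the closed period, but uniqueness has to cover every weak solution: functions up to
  null sets, weak derivatives tested on the circle, and an arbitrary choice inside
  \<open>dz\<close>. This obstacle is the reason for the product rule for absolutely continuous
  functions and for the absolutely continuous representatives of weakly differentiable ones. A
  solution may jump across the ends of the period; only its product with the speed has to match
  there.\<close>

lemma AE_zero_of_integral_atMost_zero:
  fixes g :: "real \<Rightarrow> real"
  assumes g: "integrable lborel g" and atMost: "\<And>b. (LBINT x:{..b}. g x) = 0"
    and total: "(LBINT x. g x) = 0"
  shows "AE x in lborel. g x = 0"
proof (rule sigma_finite_measure.density_zero[OF sigma_finite_lborel g])
  have int: "set_integrable lborel A g" if "A \<in> sets borel" for A
    using g that unfolding set_integrable_def by (intro integrable_mult_indicator) auto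
  have borel_eq: "sigma_sets UNIV (range (\<lambda>a::real. {..a})) = sets borel"
    by (metis borel_eq_atMost sets_measure_of top_greatest Pow_UNIV)
  fix A :: "real set" assume "A \<in> sets lborel"
  then have A: "A \<in> sigma_sets UNIV (range (\<lambda>a. {..a}))"
    by (simp add: borel_eq)
  \<comment> \<open>Half-lines are an intersection-stable generator of the Borel sets, so Dynkin's
    theorem carries the vanishing integral over to all of them; \<open>total\<close> serves the
    complement step.\<close>
  have stable: "Int_stable (range (\<lambda>a::real. {..a}))"
    by (auto simp: Int_stable_def)
  have subset_Pow_UNIV: "range (\<lambda>a::real. {..a}) \<subseteq> Pow UNIV" by simp
  show "(LBINT x:A. g x) = 0"
    using stable subset_Pow_UNIV A
  proof (induction rule: sigma_sets_induct_disjoint)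
    case (basic A)
    then show ?case using atMost by auto
  next
    case empty
    then show ?case by (simp add: set_lebesgue_integral_def)
  next
    case (compl A)
    have A': "A \<in> sets borel" using compl(1) by (simp add: borel_eq)
    have "(LBINT x:A \<union> (UNIV - A). g x) = (LBINT x:A. g x) + (LBINT x:UNIV - A. g x)"
      using A' by (intro set_integral_Un int) auto
    then show ?case using compl(2) total by (simp add: set_lebesgue_integral_def)
  next
    case (union A)
    have "A i \<in> sets borel" for i using union(2) by (auto simp: borel_eq)
    then have "(LBINT x:(\<Union>i. A i). g x) = (\<Sum>i. (LBINT x:(A i). g x))"
      using union(1) by (intro lebesgue_integral_countable_add int) (auto simp: disjoint_family_on_def)
    then show ?case using union(3) by simp
  qed
qed

text \<open>\<open>F\<close> and \<open>G\<close> are only indefinite integrals, so the rule comes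
  from Fubini's theorem and not from pointwise derivatives: \<open>(F d - F c) * (G d - G c)\<close>
  is the integral of \<open>f x * g y\<close> over a square, and cutting the square along its
  diagonal produces \<open>f * (G - G c)\<close> on one side and \<open>(F - F c) * g\<close> on the
  other.\<close>

lemma product_rule_absolutely_continuous:
  fixes f g F G :: "real \<Rightarrow> real"
  assumes cd: "c \<le> d"
    and f: "set_integrable lborel {c..d} f" and g: "set_integrable lborel {c..d} g"
    and F: "\<And>z. z \<in> {c..d} \<Longrightarrow> F z = F c + (LBINT y:{c..z}. f y)"
    and G: "\<And>z. z \<in> {c..d} \<Longrightarrow> G z = G c + (LBINT y:{c..z}. g y)"
  shows "set_integrable lborel {c..d} (\<lambda>z. f z * G z + F z * g z)"
    and "(LBINT z:{c..d}. f z * G z + F z * g z) = F d * G d - F c * G c"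
proof -
  define f' where "f' x = indicator {c..d} x * f x" for x
  define g' where "g' x = indicator {c..d} x * g x" for x
  have f': "integrable lborel f'" and g': "integrable lborel g'"
    using f g by (simp_all add: set_integrable_def f'_def[abs_def] g'_def[abs_def])
  have [measurable]: "f' \<in> borel_measurable borel" "g' \<in> borel_measurable borel"
    using f' g' by auto
  define H where "H p = f' (fst p) * g' (snd p)" for p
  have [measurable]: "H \<in> borel_measurable (lborel \<Otimes>\<^sub>M lborel)"
    unfolding H_def by measurable
  have H: "integrable (lborel \<Otimes>\<^sub>M lborel) H"
  proof (rule lborel_pair.Fubini_integrable)
    show "integrable lborel (\<lambda>x. \<integral>y. norm (H (x, y)) \<partial>lborel)"
      using f' by (simp add: H_def abs_mult)
    show "AE x in lborel. integrable lborel (\<lambda>y. H (x, y))"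
      using g' by (simp add: H_def)
  qed measurable
  define K :: "(real \<times> real) set" where "K = {p \<in> space (lborel \<Otimes>\<^sub>M lborel). snd p \<le> fst p}"
  have [measurable]: "K \<in> sets (lborel \<Otimes>\<^sub>M lborel)"
    unfolding K_def by measurable
  have H1: "integrable (lborel \<Otimes>\<^sub>M lborel) (\<lambda>p. indicator K p *\<^sub>R H p)"
    by (rule integrable_mult_indicator[OF _ H]) measurable
  have H2: "integrable (lborel \<Otimes>\<^sub>M lborel) (\<lambda>p. indicator (space (lborel \<Otimes>\<^sub>M lborel) - K) p *\<^sub>R H p)"
    by (rule integrable_mult_indicator[OF _ H]) measurable
  have H2': "integrable (lborel \<Otimes>\<^sub>M lborel)
      (\<lambda>(x, y). indicator (space (lborel \<Otimes>\<^sub>M lborel) - K) (x, y) *\<^sub>R H (x, y))"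
    using H2 by (simp only: split_def prod.collapse)
  have inG: "(\<integral>y. indicator K (x, y) *\<^sub>R H (x, y) \<partial>lborel) = indicator {c..d} x * (f x * (G x - G c))" for x
  proof (cases "x \<in> {c..d}")
    case True
    have "(\<integral>y. indicator K (x, y) *\<^sub>R H (x, y) \<partial>lborel) = (\<integral>y. f x * (indicator {c..x} y *\<^sub>R g y) \<partial>lborel)"
      using True by (intro Bochner_Integration.integral_cong)
        (auto simp: K_def H_def f'_def g'_def indicator_def space_pair_measure)
    also have "\<dots> = f x * (LBINT y:{c..x}. g y)"
      unfolding set_lebesgue_integral_def by simp
    finally show ?thesis using G[OF True] True by simp
  qed (simp add: H_def f'_def)
  have inF: "(\<integral>x. indicator (space (lborel \<Otimes>\<^sub>M lborel) - K) (x, y) *\<^sub>R H (x, y) \<partial>lborel)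
      = indicator {c..d} y * ((F y - F c) * g y)" for y
  proof (cases "y \<in> {c..d}")
    case True
    \<comment> \<open>Outside \<open>K\<close> the inequality \<open>x < y\<close> is strict, so the
      closed interval \<open>{c..y}\<close> is off by one point, a null set.\<close>
    have ne: "AE x in lborel. x \<noteq> y" by (rule AE_lborel_singleton)
    have sf: "indicator {c..y} x *\<^sub>R f x = indicator {c..y} x * f' x" for x
      using True by (auto simp: f'_def indicator_def)
    have "(\<integral>x. indicator (space (lborel \<Otimes>\<^sub>M lborel) - K) (x, y) *\<^sub>R H (x, y) \<partial>lborel)
        = (\<integral>x. (indicator {c..y} x *\<^sub>R f x) * g y \<partial>lborel)"
    proof (rule integral_cong_AE)
      show "AE x in lborel. indicator (space (lborel \<Otimes>\<^sub>M lborel) - K) (x, y) *\<^sub>R H (x, y)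
          = (indicator {c..y} x *\<^sub>R f x) * g y"
        using ne
        by eventually_elim (use True in \<open>auto simp: K_def H_def f'_def g'_def indicator_def space_pair_measure\<close>)
      show "(\<lambda>x. (indicator {c..y} x *\<^sub>R f x) * g y) \<in> borel_measurable lborel"
        unfolding sf by measurable
    qed measurable
    also have "\<dots> = (LBINT x:{c..y}. f x) * g y"
      unfolding set_lebesgue_integral_def by simp
    finally show ?thesis using F[OF True] True by simp
  next
    case False
    then show ?thesis by (simp add: H_def g'_def)
  qed
  have i1: "integrable lborel (\<lambda>x. indicator {c..d} x * (f x * (G x - G c)))"
    using lborel_pair.integrable_fst'[OF H1] unfolding inG .
  have i2: "integrable lborel (\<lambda>x. indicator {c..d} x * ((F x - F c) * g x))"
    using lborel_pair.integrable_snd[OF H2'] unfolding inF .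
  have e1: "(\<integral>x. indicator {c..d} x * (f x * (G x - G c)) \<partial>lborel)
      = (\<integral>p. indicator K p *\<^sub>R H p \<partial>(lborel \<Otimes>\<^sub>M lborel))"
    using lborel_pair.integral_fst'[OF H1] unfolding inG .
  have e2: "(\<integral>x. indicator {c..d} x * ((F x - F c) * g x) \<partial>lborel)
      = (\<integral>p. indicator (space (lborel \<Otimes>\<^sub>M lborel) - K) p *\<^sub>R H p \<partial>(lborel \<Otimes>\<^sub>M lborel))"
    using lborel_pair.integral_snd[OF H2'] unfolding inF by (simp only: split_def prod.collapse)
  have "(\<integral>p. H p \<partial>(lborel \<Otimes>\<^sub>M lborel)) = (\<integral>p. indicator K p *\<^sub>R H p
      + indicator (space (lborel \<Otimes>\<^sub>M lborel) - K) p *\<^sub>R H p \<partial>(lborel \<Otimes>\<^sub>M lborel))"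
    by (intro Bochner_Integration.integral_cong) (auto simp: indicator_def)
  also have "\<dots> = (\<integral>x. indicator {c..d} x * (f x * (G x - G c)) \<partial>lborel)
      + (\<integral>x. indicator {c..d} x * ((F x - F c) * g x) \<partial>lborel)"
    using H1 H2 by (simp add: e1 e2)
  finally have s1: "(\<integral>p. H p \<partial>(lborel \<Otimes>\<^sub>M lborel)) = \<dots>" .
  have "(\<integral>p. H p \<partial>(lborel \<Otimes>\<^sub>M lborel)) = (\<integral>x. \<integral>y. H (x, y) \<partial>lborel \<partial>lborel)"
    using lborel_pair.integral_fst'[OF H] by simp
  also have "\<dots> = (\<integral>x. f' x \<partial>lborel) * (\<integral>y. g' y \<partial>lborel)"
    by (simp add: H_def)
  also have "\<dots> = (F d - F c) * (G d - G c)"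
    using F[of d] G[of d] cd by (simp add: set_lebesgue_integral_def f'_def g'_def)
  finally have s2: "(\<integral>p. H p \<partial>(lborel \<Otimes>\<^sub>M lborel)) = (F d - F c) * (G d - G c)" .
  have split: "indicator {c..d} x *\<^sub>R (f x * G x + F x * g x)
      = indicator {c..d} x * (f x * (G x - G c)) + indicator {c..d} x * ((F x - F c) * g x)
        + (G c * f' x + F c * g' x)" for x
    by (simp add: f'_def g'_def indicator_def algebra_simps)
  show "set_integrable lborel {c..d} (\<lambda>z. f z * G z + F z * g z)"
    unfolding set_integrable_def split using i1 i2 f' g' by (intro Bochner_Integration.integrable_add integrable_mult_right)
  have "(LBINT z:{c..d}. f z * G z + F z * g z) = (F d - F c) * (G d - G c)
      + (G c * (\<integral>y. f' y \<partial>lborel) + F c * (\<integral>y. g' y \<partial>lborel))"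
    unfolding set_lebesgue_integral_def split using i1 i2 f' g' s1 s2 by simp
  also have "\<dots> = (F d - F c) * (G d - G c) + (G c * (F d - F c) + F c * (G d - G c))"
    using F[of d] G[of d] cd by (simp add: set_lebesgue_integral_def f'_def g'_def)
  finally show "(LBINT z:{c..d}. f z * G z + F z * g z) = F d * G d - F c * G c"
    by (simp add: algebra_simps)
qed

section \<open>Products of square-integrable functions and the Cauchy-Schwarz inequality\<close>

lemma square_integrable_mult:
  fixes f g :: "'a \<Rightarrow> real"
  assumes [measurable]: "f \<in> borel_measurable M" "g \<in> borel_measurable M"
    and "integrable M (\<lambda>x. (f x)\<^sup>2)" "integrable M (\<lambda>x. (g x)\<^sup>2)"
  shows "integrable M (\<lambda>x. f x * g x)"
proof (rule Bochner_Integration.integrable_bound)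
  show "integrable M (\<lambda>x. (f x)\<^sup>2 + (g x)\<^sup>2)" using assms by simp
  have "\<bar>a * b\<bar> \<le> \<bar>a\<^sup>2 + b\<^sup>2\<bar>" for a b :: real
    using sum_squares_bound[of "\<bar>a\<bar>" "\<bar>b\<bar>"] mult_nonneg_nonneg[of "\<bar>a\<bar>" "\<bar>b\<bar>"]
    by (simp add: abs_mult del: mult_nonneg_nonneg)
  then show "AE x in M. norm (f x * g x) \<le> norm ((f x)\<^sup>2 + (g x)\<^sup>2)" by simp
qed measurable

lemma square_integrable_add:
  fixes f g :: "'a \<Rightarrow> real"
  assumes [measurable]: "f \<in> borel_measurable M" "g \<in> borel_measurable M"
    and f: "integrable M (\<lambda>x. (f x)\<^sup>2)" and g: "integrable M (\<lambda>x. (g x)\<^sup>2)"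
  shows "integrable M (\<lambda>x. (f x + g x)\<^sup>2)"
  using square_integrable_mult[OF assms] f g
  by (simp add: power2_sum mult.assoc)

lemma Cauchy_Schwarz_integral:
  fixes f g :: "'a \<Rightarrow> real"
  assumes "f \<in> borel_measurable M" "g \<in> borel_measurable M"
    and f: "integrable M (\<lambda>x. (f x)\<^sup>2)" and g: "integrable M (\<lambda>x. (g x)\<^sup>2)"
  shows "\<bar>\<integral>x. f x * g x \<partial>M\<bar> \<le> sqrt (\<integral>x. (f x)\<^sup>2 \<partial>M) * sqrt (\<integral>x. (g x)\<^sup>2 \<partial>M)"
proof -
  define P Q R where "P = (\<integral>x. (f x)\<^sup>2 \<partial>M)" and "Q = (\<integral>x. (g x)\<^sup>2 \<partial>M)"
    and "R = (\<integral>x. f x * g x \<partial>M)"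
  have fg: "integrable M (\<lambda>x. f x * g x)" by (rule square_integrable_mult) fact+
  have quad: "0 \<le> r\<^sup>2 * P + 2 * (r * s) * R + s\<^sup>2 * Q" for r s
  proof -
    have "0 \<le> (\<integral>x. (r * f x + s * g x)\<^sup>2 \<partial>M)" by simp
    also have "\<dots> = (\<integral>x. r\<^sup>2 * (f x)\<^sup>2 + 2 * (r * s) * (f x * g x) + s\<^sup>2 * (g x)\<^sup>2 \<partial>M)"
      by (intro Bochner_Integration.integral_cong) (auto simp: power2_eq_square algebra_simps)
    also have "\<dots> = r\<^sup>2 * P + 2 * (r * s) * R + s\<^sup>2 * Q"
      using f g fg by (simp add: P_def Q_def R_def)
    finally show ?thesis .
  qed
  have nn: "0 \<le> P" "0 \<le> Q" by (simp_all add: P_def Q_def)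
  have "R\<^sup>2 \<le> P * Q"
  proof (cases "Q = 0")
    case True
    have "R = 0"
    proof (rule ccontr)
      assume "R \<noteq> 0"
      \<comment> \<open>For \<open>Q = 0\<close> and \<open>r = 1\<close> the form is affine in
        \<open>s\<close>; this choice of \<open>s\<close> gives it the value
        \<open>P - (P + 1) = - 1\<close>.\<close>
      then have "2 * (1 * (- (P + 1) / (2 * R))) * R = - (P + 1)" by (simp add: field_simps)
      then show False using quad[of 1 "- (P + 1) / (2 * R)"] True by simp
    qed
    then show ?thesis using nn by simp
  next
    case False
    then have "0 < Q" using nn by simp
    moreover have "0 \<le> Q * (P * Q - R\<^sup>2)"
      using quad[of Q "- R"] by (simp add: power2_eq_square algebra_simps)
    ultimately show ?thesis by (simp add: zero_le_mult_iff)
  qed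
  then have "sqrt (R\<^sup>2) \<le> sqrt (P * Q)" by (rule real_sqrt_le_mono)
  then show ?thesis by (simp add: real_sqrt_mult P_def Q_def R_def)
qed

subsection \<open>Periodic square-integrable functions\<close>

lemma L2_perD:
  assumes "f \<in> L2_per"
  shows "f \<in> borel_measurable borel" "\<And>z. f (z + 2 * pi) = f z"
    "set_integrable lborel {-pi..pi} (\<lambda>z. (f z)\<^sup>2)"
  using assms by (auto simp: L2_per_def periodic_fun_simple_def)

lemma L2_perI:
  assumes "f \<in> borel_measurable borel" "\<And>z. f (z + 2 * pi) = f z"
    "set_integrable lborel {-pi..pi} (\<lambda>z. (f z)\<^sup>2)"
  shows "f \<in> L2_per"
  using assms by (auto simp: L2_per_def periodic_fun_simple_def)

lemma indicator_mult_square: "(indicator A z * x)\<^sup>2 = indicator A z * (x::real)\<^sup>2"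
  by (auto simp: indicator_def)

lemma L2_per_square_integrable:
  "f \<in> L2_per \<Longrightarrow> integrable lborel (\<lambda>z. (indicator {-pi..pi} z * f z)\<^sup>2)"
  using L2_perD(3)[of f] by (simp add: set_integrable_def indicator_mult_square)

lemma L2_norm_square: "f \<in> L2_per \<Longrightarrow> (L2_norm f)\<^sup>2 = (LBINT z:{-pi..pi}. (f z)\<^sup>2)"
  unfolding L2_norm_def set_lebesgue_integral_def by simp

lemma L2_norm_nonneg [simp]: "0 \<le> L2_norm f"
  unfolding L2_norm_def set_lebesgue_integral_def by simp

lemma L2_mult_integrable:
  assumes "f \<in> L2_per" "g \<in> L2_per"
  shows "set_integrable lborel {-pi..pi} (\<lambda>z. f z * g z)"
proof -
  have [measurable]: "f \<in> borel_measurable borel" "g \<in> borel_measurable borel"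
    using assms by (auto simp: L2_perD)
  have "integrable lborel (\<lambda>z. (indicator {-pi..pi} z * f z) * (indicator {-pi..pi} z * g z))"
    by (intro square_integrable_mult L2_per_square_integrable assms) measurable
  then show ?thesis unfolding set_integrable_def
    by (rule Bochner_Integration.integrable_cong[THEN iffD1, rotated 2]) (auto simp: indicator_def)
qed

lemma L2_Cauchy_Schwarz:
  assumes "f \<in> L2_per" "g \<in> L2_per"
  shows "\<bar>LBINT z:{-pi..pi}. f z * g z\<bar> \<le> L2_norm f * L2_norm g"
proof -
  have [measurable]: "f \<in> borel_measurable borel" "g \<in> borel_measurable borel"
    using assms by (auto simp: L2_perD)
  have eq: "(LBINT z:{-pi..pi}. f z * g z)
      = (\<integral>z. (indicator {-pi..pi} z * f z) * (indicator {-pi..pi} z * g z) \<partial>lborel)"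
    unfolding set_lebesgue_integral_def
    by (intro Bochner_Integration.integral_cong) (auto simp: indicator_def)
  have "\<bar>LBINT z:{-pi..pi}. f z * g z\<bar> \<le> sqrt (\<integral>z. (indicator {-pi..pi} z * f z)\<^sup>2 \<partial>lborel)
      * sqrt (\<integral>z. (indicator {-pi..pi} z * g z)\<^sup>2 \<partial>lborel)"
    unfolding eq by (intro Cauchy_Schwarz_integral L2_per_square_integrable assms) measurable
  then show ?thesis
    by (simp add: L2_norm_def set_lebesgue_integral_def indicator_mult_square)
qed

lemma L2_per_add:
  assumes "f \<in> L2_per" "g \<in> L2_per"
  shows "(\<lambda>z. f z + g z) \<in> L2_per"
proof (rule L2_perI)
  have [measurable]: "f \<in> borel_measurable borel" "g \<in> borel_measurable borel"
    using assms by (auto simp: L2_perD)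
  show "(\<lambda>z. f z + g z) \<in> borel_measurable borel" by measurable
  show "f (z + 2 * pi) + g (z + 2 * pi) = f z + g z" for z
    by (simp add: L2_perD(2)[OF assms(1)] L2_perD(2)[OF assms(2)])
  have "integrable lborel (\<lambda>z. (indicator {-pi..pi} z * f z + indicator {-pi..pi} z * g z)\<^sup>2)"
    by (intro square_integrable_add L2_per_square_integrable assms) measurable
  then show "set_integrable lborel {-pi..pi} (\<lambda>z. (f z + g z)\<^sup>2)"
    unfolding set_integrable_def
    by (rule Bochner_Integration.integrable_cong[THEN iffD1, rotated 2]) (auto simp: indicator_def)
qed

lemma L2_per_cmult:
  assumes "f \<in> L2_per"
  shows "(\<lambda>z. c * f z) \<in> L2_per"
proof (rule L2_perI)
  show "(\<lambda>z. c * f z) \<in> borel_measurable borel"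
    using L2_perD(1)[OF assms] by measurable
  show "c * f (z + 2 * pi) = c * f z" for z
    by (simp add: L2_perD(2)[OF assms])
  show "set_integrable lborel {-pi..pi} (\<lambda>z. (c * f z)\<^sup>2)"
    using L2_perD(3)[OF assms] by (simp add: power_mult_distrib)
qed

lemma L2_per_diff: "f \<in> L2_per \<Longrightarrow> g \<in> L2_per \<Longrightarrow> (\<lambda>z. f z - g z) \<in> L2_per"
  using L2_per_add[of f "\<lambda>z. (-1) * g z"] L2_per_cmult[of g "-1"] by simp

lemma L2_per_bounded:
  assumes [measurable]: "f \<in> borel_measurable borel" and "\<And>z. f (z + 2 * pi) = f z"
    and bound: "\<And>z. z \<in> {-pi..pi} \<Longrightarrow> \<bar>f z\<bar> \<le> B"
  shows "f \<in> L2_per"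
proof (rule L2_perI)
  show "set_integrable lborel {-pi..pi} (\<lambda>z. (f z)\<^sup>2)"
  proof (rule set_integrable_bound)
    show "set_integrable lborel {-pi..pi} (\<lambda>z. B\<^sup>2)"
      by (simp add: set_integrable_def)
    show "set_borel_measurable lborel {-pi..pi} (\<lambda>z. (f z)\<^sup>2)"
      unfolding set_borel_measurable_def by measurable
    show "AE z in lborel. z \<in> {-pi..pi} \<longrightarrow> norm ((f z)\<^sup>2) \<le> norm (B\<^sup>2)"
    proof (intro AE_I2 impI)
      fix z assume "z \<in> {-pi..pi}"
      from bound[OF this] have "\<bar>f z\<bar>\<^sup>2 \<le> B\<^sup>2" by (intro power_mono) auto
      then show "norm ((f z)\<^sup>2) \<le> norm (B\<^sup>2)" by simp
    qed
  qed
qed fact+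

lemma L2_per_const: "(\<lambda>z. c) \<in> L2_per"
  by (rule L2_per_bounded[where B="\<bar>c\<bar>"]) auto

lemma L2_per_integrable: "f \<in> L2_per \<Longrightarrow> set_integrable lborel {-pi..pi} f"
  using L2_mult_integrable[of f "\<lambda>z. 1", OF _ L2_per_const] by simp

lemma L2_per_continuous:
  assumes "continuous_on UNIV f" "\<And>z. f (z + 2 * pi) = f z"
  shows "f \<in> L2_per"
proof -
  have "compact (f ` {-pi..pi})"
    using assms(1) by (intro compact_continuous_image) (auto intro: continuous_on_subset)
  then obtain B where "\<And>z. z \<in> {-pi..pi} \<Longrightarrow> \<bar>f z\<bar> \<le> B"
    by (fastforce dest!: compact_imp_bounded simp: bounded_iff)
  then show ?thesis
    using assms by (intro L2_per_bounded) (auto intro: borel_measurable_continuous_onI)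
qed

lemma L2_norm_triangle:
  assumes f: "f \<in> L2_per" and g: "g \<in> L2_per"
  shows "L2_norm (\<lambda>z. f z + g z) \<le> L2_norm f + L2_norm g"
proof (rule power2_le_imp_le)
  have "(L2_norm (\<lambda>z. f z + g z))\<^sup>2 = (LBINT z:{-pi..pi}. (f z)\<^sup>2 + (2 * (f z * g z) + (g z)\<^sup>2))"
    using L2_norm_square[OF L2_per_add[OF f g]] by (simp add: power2_sum algebra_simps)
  also have "\<dots> = (L2_norm f)\<^sup>2 + (2 * (LBINT z:{-pi..pi}. f z * g z) + (L2_norm g)\<^sup>2)"
    using L2_perD(3)[OF f] L2_perD(3)[OF g] L2_mult_integrable[OF f g] f g
    by (simp add: set_integral_add L2_norm_square)
  also have "\<dots> \<le> (L2_norm f + L2_norm g)\<^sup>2"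
    using L2_Cauchy_Schwarz[OF f g] by (simp add: power2_sum)
  finally show "(L2_norm (\<lambda>z. f z + g z))\<^sup>2 \<le> (L2_norm f + L2_norm g)\<^sup>2" .
qed simp

lemma L2_norm_cmult: "L2_norm (\<lambda>z. c * f z) = \<bar>c\<bar> * L2_norm f"
  by (simp add: L2_norm_def power_mult_distrib real_sqrt_mult)

lemma L2_norm_zero_AE:
  assumes f: "f \<in> L2_per" and "L2_norm f = 0"
  shows "AE z in lborel. z \<in> {-pi..pi} \<longrightarrow> f z = 0"
proof -
  have "(\<integral>z. (indicator {-pi..pi} z * f z)\<^sup>2 \<partial>lborel) = 0"
    using assms L2_norm_square[OF f]
    by (simp add: set_lebesgue_integral_def indicator_mult_square)
  then have "AE z in lborel. (indicator {-pi..pi} z * f z)\<^sup>2 = 0"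
    using integral_nonneg_eq_0_iff_AE[OF L2_per_square_integrable[OF f]] by simp
  then show ?thesis by eventually_elim (auto simp: indicator_def)
qed

lemma L2_norm_cong_AE:
  assumes f: "f \<in> borel_measurable borel" and g: "g \<in> borel_measurable borel"
    and "AE z in lborel. z \<in> {-pi..pi} \<longrightarrow> f z = g z"
  shows "L2_norm f = L2_norm g"
  unfolding L2_norm_def
  using assms by (intro arg_cong[where f=sqrt] set_lebesgue_integral_cong_AE) auto

section \<open>From one period to the whole line\<close>

lemma period_index:
  obtains k :: int where "-pi + 2 * pi * of_int k \<le> z" "z < pi + 2 * pi * of_int k"
proof -
  define k where "k = \<lfloor>(z + pi) / (2 * pi)\<rfloor>"
  have "of_int k \<le> (z + pi) / (2 * pi)" "(z + pi) / (2 * pi) < of_int k + 1"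
    unfolding k_def by linarith+
  then have "of_int k * (2 * pi) \<le> z + pi" "z + pi < (of_int k + 1) * (2 * pi)"
    using pos_le_divide_eq[of "2 * pi" "of_int k" "z + pi"]
      pos_divide_less_eq[of "2 * pi" "z + pi" "of_int k + 1"]
    by (simp_all only: pi_gt_zero zero_less_mult_iff zero_less_numeral simp_thms)
  then show thesis by (intro that[of k]) (auto simp: algebra_simps)
qed

text \<open>The exceptional set on the line is covered by countably many translates of one null
  set.\<close>

lemma AE_of_AE_period:
  assumes per: "\<And>z. P (z + 2 * pi) = P z" and AE: "AE z in lborel. z \<in> {-pi..pi} \<longrightarrow> P z"
  shows "AE z in lborel. P z"
proof -
  obtain N where N: "{z \<in> space lborel. \<not> (z \<in> {-pi..pi} \<longrightarrow> P z)} \<subseteq> N" "N \<in> null_sets lborel"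
    using AE by (auto elim!: AE_E simp: null_sets_def)
  have [measurable]: "N \<in> sets borel" using N(2) by auto
  have "AE z in lborel. z \<notin> N" using N(2) by (rule AE_not_in)
  then have "AE z in lborel. 2 * pi * of_int n + 1 * z \<notin> N" for n :: int
    by (intro AE_borel_affine) auto
  then have "AE z in lborel. \<forall>n::int. 2 * pi * of_int n + z \<notin> N"
    by (simp add: AE_all_countable)
  then show ?thesis
  proof eventually_elim
    fix z assume z: "\<forall>n::int. 2 * pi * of_int n + z \<notin> N"
    interpret periodic_fun_simple P "2 * pi" by standard (rule per)
    obtain k where k: "-pi + 2 * pi * of_int k \<le> z" "z < pi + 2 * pi * of_int k"
      using period_index .
    define n where "n = - k"
    have "2 * pi * of_int n + z \<in> {-pi..pi}" using k by (auto simp: n_def)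
    moreover have "2 * pi * of_int n + z \<notin> N" using z by blast
    ultimately have "P (2 * pi * of_int n + z)" using N(1) by auto
    then show "P z" using plus_of_int[of z n] by (simp add: algebra_simps)
  qed
qed

section \<open>Smooth periodic test functions\<close>

lemma smooth_per_deriv: "smooth_per \<phi> \<Longrightarrow> smooth_per (deriv \<phi>)"
  unfolding smooth_per_def periodic_fun_simple_def
proof safe
  fix z n
  assume per: "\<forall>x. \<phi> (x + 2 * pi) = \<phi> x" and diff: "\<forall>n z. (deriv ^^ n) \<phi> differentiable (at z)"
  have "(\<phi> has_real_derivative deriv \<phi> (z + 2 * pi)) (at (z + 2 * pi))"
    using diff[rule_format, of 0 "z + 2 * pi"] by (simp add: DERIV_deriv_iff_real_differentiable)
  then have "((\<lambda>x. \<phi> (x + 2 * pi)) has_real_derivative deriv \<phi> (z + 2 * pi)) (at z)"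
    by (simp add: DERIV_shift)
  then show "deriv \<phi> (z + 2 * pi) = deriv \<phi> z"
    using per by (simp add: DERIV_imp_deriv)
  show "(deriv ^^ n) (deriv \<phi>) differentiable at z"
    using diff[rule_format, of "Suc n" z] by (simp add: funpow_Suc_right del: funpow.simps)
qed

lemma smooth_per_has_deriv:
  "smooth_per \<phi> \<Longrightarrow> (\<phi> has_real_derivative deriv \<phi> z) (at z)"
  unfolding smooth_per_def
  by (metis DERIV_deriv_iff_real_differentiable funpow_0)

lemma smooth_per_continuous: "smooth_per \<phi> \<Longrightarrow> continuous_on A \<phi>"
  by (meson DERIV_isCont continuous_at_imp_continuous_on smooth_per_has_deriv)

lemma smooth_per_L2: "smooth_per \<phi> \<Longrightarrow> \<phi> \<in> L2_per"
  by (rule L2_per_continuous) (auto simp: smooth_per_continuous smooth_per_def periodic_fun_simple_def)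

lemma smooth_per_of_antiderivative:
  assumes \<psi>: "smooth_per \<psi>" and \<phi>: "\<And>z. (\<phi> has_real_derivative \<psi> z) (at z)"
    and per: "\<And>z. \<phi> (z + 2 * pi) = \<phi> z"
  shows "smooth_per \<phi>"
  unfolding smooth_per_def periodic_fun_simple_def
proof safe
  have d: "deriv \<phi> = \<psi>" using \<phi> by (auto intro: DERIV_imp_deriv)
  fix n z
  show "(deriv ^^ n) \<phi> differentiable at z"
  proof (cases n)
    case 0
    then show ?thesis using \<phi> by (auto simp: real_differentiable_def)
  next
    case (Suc m)
    then show ?thesis using \<psi>
      by (simp add: funpow_Suc_right d smooth_per_def del: funpow.simps)
  qed
qed (rule per)

lemma has_real_derivative_Re_of_real:
  assumes "(\<Phi> has_field_derivative D) (at (complex_of_real x))"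
  shows "((\<lambda>x. Re (\<Phi> (of_real x))) has_real_derivative Re D) (at x)"
proof -
  have "((\<lambda>x. \<Phi> (of_real x)) has_vector_derivative D) (at x)"
    using has_vector_derivative_real_field[OF assms] by simp
  then have "((\<lambda>x. Re (\<Phi> (of_real x))) has_vector_derivative Re D) (at x)"
    by (rule bounded_linear.has_vector_derivative[OF bounded_linear_Re])
  then show ?thesis by (simp add: has_real_derivative_iff_has_vector_derivative)
qed

text \<open>The iterated real derivatives are the real parts of the iterated complex ones, which all
  exist for an entire function. This gives smoothness of a test function without formulas for its
  higher derivatives.\<close>

lemma smooth_per_Re_entire:
  assumes \<Phi>: "\<Phi> holomorphic_on UNIV" and per: "\<And>x. Re (\<Phi> (of_real (x + 2 * pi))) = Re (\<Phi> (of_real x))"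
  shows "smooth_per (\<lambda>x. Re (\<Phi> (of_real x)))"
proof -
  have D: "((\<lambda>x. Re ((deriv ^^ n) \<Phi> (of_real x))) has_real_derivative
      Re ((deriv ^^ Suc n) \<Phi> (of_real x))) (at x)" for n x
    using holomorphic_higher_deriv[OF \<Phi>, of n]
    by (intro has_real_derivative_Re_of_real) (auto intro: holomorphic_derivI)
  have eq: "(deriv ^^ n) (\<lambda>x. Re (\<Phi> (of_real x))) = (\<lambda>x. Re ((deriv ^^ n) \<Phi> (of_real x)))" for n
  proof (induction n)
    case (Suc n)
    then show ?case using D[of n] by (auto intro!: DERIV_imp_deriv ext)
  qed simp
  show ?thesis
    unfolding smooth_per_def periodic_fun_simple_def
  proof safe
    fix n z
    show "(deriv ^^ n) (\<lambda>x. Re (\<Phi> (of_real x))) differentiable at z"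
      unfolding eq using D[of n z] by (auto simp: real_differentiable_def)
  qed (rule per)
qed

subsection \<open>Uniqueness of weak derivatives\<close>

text \<open>The test function is entire, takes values in the unit interval and tends pointwise to the
  indicator of \<open>z < b\<close> on the open period as \<open>n\<close> grows.\<close>

definition step_test :: "real \<Rightarrow> nat \<Rightarrow> real \<Rightarrow> real" where
  "step_test b n z = exp (- exp (- real n * (cos (z / 2) * sin ((b - z) / 2))))"

lemma smooth_per_step_test: "smooth_per (step_test b n)"
proof -
  define \<Phi> :: "complex \<Rightarrow> complex" where
    "\<Phi> = (\<lambda>z. exp (- exp (- of_nat n * (cos (z / 2) * sin ((of_real b - z) / 2)))))"
  have eq: "Re (\<Phi> (of_real z)) = step_test b n z" for z
  proof -
    have "\<Phi> (of_real z) = of_real (step_test b n z)"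
      by (simp add: \<Phi>_def step_test_def flip: exp_of_real cos_of_real sin_of_real)
    then show ?thesis by simp
  qed
  \<comment> \<open>A shift by \<open>2 * pi\<close> changes the sign of both half-angle factors, so
    their product is unchanged.\<close>
  have per: "step_test b n (z + 2 * pi) = step_test b n z" for z
  proof -
    have "(z + 2 * pi) / 2 = z / 2 + pi" "(b - (z + 2 * pi)) / 2 = (b - z) / 2 - pi"
      by (simp_all add: field_simps)
    then show ?thesis unfolding step_test_def by (simp only: sin_diff) simp
  qed
  have "smooth_per (\<lambda>z. Re (\<Phi> (of_real z)))"
  proof (rule smooth_per_Re_entire)
    show "\<Phi> holomorphic_on UNIV" unfolding \<Phi>_def by (intro holomorphic_intros) auto
  qed (simp only: eq per)
  then show ?thesis by (simp add: eq)
qed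

lemma step_test_bounds: "0 \<le> step_test b n z" "step_test b n z \<le> 1"
  by (simp_all add: step_test_def)

lemma step_test_limit:
  assumes z: "z \<in> {-pi<..<pi}" and b: "b \<in> {-pi..pi}" "z \<noteq> b"
  shows "(\<lambda>n. step_test b n z) \<longlonglongrightarrow> indicator {..b} z"
proof -
  \<comment> \<open>The cosine is positive on the open period and \<open>(b - z) / 2\<close> stays
    between \<open>- pi\<close> and \<open>pi\<close>, so \<open>p\<close> has the sign of
    \<open>b - z\<close>; the double exponential turns this sign into the limit 1 or 0.\<close>
  define p where "p = cos (z / 2) * sin ((b - z) / 2)"
  have c: "0 < cos (z / 2)" using z by (intro cos_gt_zero_pi) auto
  have lim: "filterlim (\<lambda>n. real n * r) at_top sequentially" if "0 < r" for r
    using filterlim_tendsto_pos_mult_at_top[OF tendsto_const[of r] that filterlim_real_sequentially]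
    by (simp add: mult.commute)
  show ?thesis
  proof (cases "z < b")
    case True
    then have "0 < p" using c z b by (auto simp: p_def intro!: mult_pos_pos sin_gt_zero)
    from lim[OF this] have "filterlim (\<lambda>n. - (real n * p)) at_bot sequentially"
      by (simp add: filterlim_uminus_at_bot)
    then have "(\<lambda>n. exp (- (real n * p))) \<longlonglongrightarrow> 0"
      by (rule filterlim_compose[OF exp_at_bot])
    then have "(\<lambda>n. exp (- exp (- (real n * p)))) \<longlonglongrightarrow> exp (- 0)"
      by (intro tendsto_exp tendsto_minus)
    then show ?thesis using True by (simp add: step_test_def p_def indicator_def)
  next
    case False
    then have "0 < sin ((z - b) / 2)" using b z by (intro sin_gt_zero) auto
    moreover have "sin ((b - z) / 2) = - sin ((z - b) / 2)"
      by (metis minus_diff_eq minus_divide_left sin_minus)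
    ultimately have "0 < - p" using c by (auto simp: p_def)
    from lim[OF this] have "filterlim (\<lambda>n. exp (real n * (- p))) at_top sequentially"
      by (rule filterlim_compose[OF exp_at_top])
    then have "filterlim (\<lambda>n. - exp (real n * (- p))) at_bot sequentially"
      by (simp add: filterlim_uminus_at_bot)
    then have "(\<lambda>n. exp (- exp (real n * (- p)))) \<longlonglongrightarrow> 0"
      by (rule filterlim_compose[OF exp_at_bot])
    then show ?thesis using False b by (simp add: step_test_def p_def indicator_def)
  qed
qed

lemma smooth_per_const: "smooth_per (\<lambda>_. c)"
  using smooth_per_Re_entire[of "\<lambda>_. of_real c"] by simp

text \<open>Dominated convergence along \<open>step_test b\<close> replaces the test function by the
  indicator of \<open>{..b}\<close>, so all integrals over half-lines vanish. The total integral
  comes from the constant test function, which is admissible on the circle.\<close>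

lemma fundamental_lemma_per:
  assumes g: "set_integrable lborel {-pi..pi} g"
    and test: "\<And>\<phi>. smooth_per \<phi> \<Longrightarrow> (LBINT z:{-pi..pi}. g z * \<phi> z) = 0"
  shows "AE z in lborel. z \<in> {-pi..pi} \<longrightarrow> g z = 0"
proof -
  define h where "h z = indicator {-pi..pi} z * g z" for z
  have h: "integrable lborel h" using g by (simp add: set_integrable_def h_def[abs_def])
  have [measurable]: "h \<in> borel_measurable borel" using h by auto
  have test': "(\<integral>z. h z * \<phi> z \<partial>lborel) = 0" if "smooth_per \<phi>" for \<phi>
    using test[OF that] by (simp add: set_lebesgue_integral_def h_def mult.assoc)
  have total: "(\<integral>z. h z \<partial>lborel) = 0" using test'[OF smooth_per_const[of 1]] by simp
  have "AE z in lborel. h z = 0"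
  proof (rule AE_zero_of_integral_atMost_zero[OF h _ total])
    fix b
    consider "b < -pi" | "pi < b" | "b \<in> {-pi..pi}" by fastforce
    then show "(LBINT z:{..b}. h z) = 0"
    proof cases
      case 1
      then have "(LBINT z:{..b}. h z) = (LBINT z:{..b}. 0)"
        by (intro set_lebesgue_integral_cong) (auto simp: h_def)
      then show ?thesis by simp
    next
      case 2
      then have "(LBINT z:{..b}. h z) = (\<integral>z. h z \<partial>lborel)"
        unfolding set_lebesgue_integral_def
        by (intro Bochner_Integration.integral_cong) (auto simp: h_def indicator_def)
      then show ?thesis using total by simp
    next
      case 3
      have meas: "step_test b n \<in> borel_measurable borel" for n
        by (intro borel_measurable_continuous_onI smooth_per_continuous smooth_per_step_test)
      have "(\<lambda>n. \<integral>z. h z * step_test b n z \<partial>lborel) \<longlonglongrightarrow> (\<integral>z. h z * indicator {..b} z \<partial>lborel)"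
      proof (rule integral_dominated_convergence)
        show "(\<lambda>z. h z * step_test b n z) \<in> borel_measurable lborel" for n
          using meas[of n] by measurable
        show "integrable lborel (\<lambda>z. \<bar>h z\<bar>)" using h by simp
        show "AE z in lborel. norm (h z * step_test b n z) \<le> \<bar>h z\<bar>" for n
          using step_test_bounds[of b n] by (auto simp: abs_mult intro!: AE_I2 mult_left_le)
        have "AE z in lborel. z \<noteq> b \<and> z \<noteq> pi \<and> z \<noteq> -pi"
          using AE_lborel_singleton[of b] AE_lborel_singleton[of pi] AE_lborel_singleton[of "-pi"]
          by auto
        then show "AE z in lborel. (\<lambda>n. h z * step_test b n z) \<longlonglongrightarrow> h z * indicator {..b} z"
        proof eventually_elim
          fix z assume z: "z \<noteq> b \<and> z \<noteq> pi \<and> z \<noteq> -pi"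
          show "(\<lambda>n. h z * step_test b n z) \<longlonglongrightarrow> h z * indicator {..b} z"
          proof (cases "z \<in> {-pi<..<pi}")
            case True
            then show ?thesis using z 3 by (intro tendsto_mult tendsto_const step_test_limit) auto
          next
            case False
            then have "h z = 0" using z by (auto simp: h_def)
            then show ?thesis by simp
          qed
        qed
      qed measurable
      then have "(\<integral>z. h z * indicator {..b} z \<partial>lborel) = 0"
        by (simp add: test' smooth_per_step_test LIMSEQ_const_iff)
      then show ?thesis by (simp add: set_lebesgue_integral_def mult.commute)
    qed
  qed
  then show ?thesis by eventually_elim (auto simp: h_def)
qed

lemma weak_deriv_unique:
  assumes "g \<in> L2_per" "has_weak_deriv_per f g" "g' \<in> L2_per" "has_weak_deriv_per f g'"
  shows "AE z in lborel. g z = g' z"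
proof -
  have "AE z in lborel. z \<in> {-pi..pi} \<longrightarrow> g z - g' z = 0"
  proof (rule fundamental_lemma_per)
    show "set_integrable lborel {-pi..pi} (\<lambda>z. g z - g' z)"
      by (intro L2_per_integrable L2_per_diff assms)
    fix \<phi> assume \<phi>: "smooth_per \<phi>"
    have "(LBINT z:{-pi..pi}. (g z - g' z) * \<phi> z)
        = (LBINT z:{-pi..pi}. g z * \<phi> z) - (LBINT z:{-pi..pi}. g' z * \<phi> z)"
      unfolding left_diff_distrib
      by (intro set_integral_diff L2_mult_integrable smooth_per_L2 assms \<phi>)
    then show "(LBINT z:{-pi..pi}. (g z - g' z) * \<phi> z) = 0"
      using assms(2,4) \<phi> by (simp add: has_weak_deriv_per_def)
  qed
  then have "AE z in lborel. g z - g' z = 0"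
    by (rule AE_of_AE_period[rotated]) (simp add: L2_perD(2)[OF assms(1)] L2_perD(2)[OF assms(3)])
  then show ?thesis by eventually_elim simp
qed

lemma dz_of_H1:
  assumes "f \<in> H1_per"
  shows "dz f \<in> L2_per" "has_weak_deriv_per f (dz f)"
proof -
  have "\<exists>g. g \<in> L2_per \<and> has_weak_deriv_per f g" using assms by (auto simp: H1_per_def)
  from someI_ex[OF this] show "dz f \<in> L2_per" "has_weak_deriv_per f (dz f)"
    by (simp_all add: dz_def)
qed

lemma dz_eq_AE:
  assumes "f \<in> L2_per" "g \<in> L2_per" "has_weak_deriv_per f g"
  shows "AE z in lborel. dz f z = g z"
proof -
  have "f \<in> H1_per" using assms by (auto simp: H1_per_def)
  then show ?thesis using dz_of_H1 assms by (blast intro: weak_deriv_unique)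
qed

lemma has_weak_deriv_per_diff:
  assumes "f \<in> L2_per" "g \<in> L2_per" "f' \<in> L2_per" "g' \<in> L2_per"
    "has_weak_deriv_per f g" "has_weak_deriv_per f' g'"
  shows "has_weak_deriv_per (\<lambda>z. f z - f' z) (\<lambda>z. g z - g' z)"
  unfolding has_weak_deriv_per_def
proof (intro allI impI)
  fix \<phi> assume \<phi>: "smooth_per \<phi>"
  have 1: "set_integrable lborel {-pi..pi} (\<lambda>z. h z * \<phi> z)"
    "set_integrable lborel {-pi..pi} (\<lambda>z. h z * deriv \<phi> z)" if "h \<in> L2_per" for h
    using that \<phi> by (auto intro!: L2_mult_integrable smooth_per_L2 smooth_per_deriv)
  show "(LBINT z:{-pi..pi}. (f z - f' z) * deriv \<phi> z) = - (LBINT z:{-pi..pi}. (g z - g' z) * \<phi> z)"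
    using assms(5,6) \<phi> unfolding has_weak_deriv_per_def left_diff_distrib
    by (simp only: set_integral_diff 1 assms(1-4) minus_diff_eq)
qed

lemma has_weak_deriv_per_cmult:
  "has_weak_deriv_per f g \<Longrightarrow> has_weak_deriv_per (\<lambda>z. c * f z) (\<lambda>z. c * g z)"
  unfolding has_weak_deriv_per_def by (simp only: mult.assoc set_integral_mult_right) simp

subsection \<open>The transport term\<close>

lemma continuous_on_indefinite_integral:
  fixes g :: "real \<Rightarrow> real"
  assumes g: "set_integrable lborel {c..d} g"
  shows "continuous_on {c..d} (\<lambda>z. LBINT y:{c..z}. g y)"
proof -
  have "continuous_on {c..d} (\<lambda>z. integral {c..z} g)"
    by (rule indefinite_integral_continuous_1[OF set_borel_integral_eq_integral(1)[OF g]])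
  then show ?thesis
  proof (rule continuous_on_eq)
    fix z assume "z \<in> {c..d}"
    then have "set_integrable lborel {c..z} g"
      by (intro set_integrable_subset[OF g]) auto
    then show "integral {c..z} g = (LBINT y:{c..z}. g y)"
      by (simp add: set_borel_integral_eq_integral)
  qed
qed

lemma integral_of_C1:
  fixes F f :: "real \<Rightarrow> real"
  assumes F: "\<And>x. x \<in> {c..d} \<Longrightarrow> (F has_real_derivative f x) (at x within {c..d})"
    and f: "continuous_on {c..d} f" and z: "z \<in> {c..d}"
  shows "F z = F c + (LBINT y:{c..z}. f y)"
proof -
  have "(LBINT y:{c..z}. f y) = F z - F c"
    unfolding set_lebesgue_integral_def
  proof (rule integral_FTC_atLeastAtMost)
    fix x assume "c \<le> x" "x \<le> z"
    then show "(F has_vector_derivative f x) (at x within {c..z})"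
      using F[of x] z by (auto simp flip: has_real_derivative_iff_has_vector_derivative
        intro: DERIV_subset)
  qed (use z f in \<open>auto intro: continuous_on_subset\<close>)
  then show ?thesis by simp
qed

lemma smooth_per_add_const: "smooth_per \<psi> \<Longrightarrow> smooth_per (\<lambda>z. \<psi> z + c)"
  by (rule smooth_per_of_antiderivative[OF smooth_per_deriv])
    (auto intro!: derivative_eq_intros smooth_per_has_deriv
      dest: smooth_per_L2 L2_perD(2))

text \<open>An antiderivative of a periodic function changes by a fixed amount over each period, and
  that amount is the integral of \<open>\<psi>\<close> over one period.\<close>

lemma smooth_per_antiderivative_exists:
  assumes \<psi>: "smooth_per \<psi>" and mean: "(LBINT z:{-pi..pi}. \<psi> z) = 0"
  obtains \<phi> where "smooth_per \<phi>" "deriv \<phi> = \<psi>"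
proof -
  have "isCont \<psi> x" for x
    using smooth_per_has_deriv[OF \<psi>] by (rule DERIV_isCont)
  then obtain \<phi> where "\<forall>x. (\<phi> has_vector_derivative \<psi> x) (at x)"
    using einterval_antiderivative[of "-\<infinity>" "\<infinity>" \<psi>] by auto
  then have \<phi>: "(\<phi> has_real_derivative \<psi> x) (at x)" for x
    by (simp add: has_real_derivative_iff_has_vector_derivative)
  have \<psi>_per: "\<psi> (z + 2 * pi) = \<psi> z" for z
    using \<psi> by (simp add: smooth_per_def periodic_fun_simple_def)
  have "((\<lambda>z. \<phi> (z + 2 * pi) - \<phi> z) has_real_derivative 0) (at z)" for z
  proof -
    have "((\<lambda>z. \<phi> (z + 2 * pi)) has_real_derivative \<psi> (z + 2 * pi)) (at z)"
      using \<phi>[of "z + 2 * pi"] by (simp only: DERIV_shift)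
    from DERIV_diff[OF this \<phi>[of z]] show ?thesis by (simp add: \<psi>_per)
  qed
  then have "\<phi> (z + 2 * pi) - \<phi> z = \<phi> (-pi + 2 * pi) - \<phi> (-pi)" for z
    by (intro DERIV_isconst_all) auto
  moreover have "\<phi> pi = \<phi> (-pi) + (LBINT y:{-pi..pi}. \<psi> y)"
    using smooth_per_continuous[OF \<psi>] \<phi> by (intro integral_of_C1) (auto intro: DERIV_subset)
  ultimately have "\<phi> (z + 2 * pi) = \<phi> z" for z using mean by (simp add: algebra_simps)
  with \<psi> \<phi> have "smooth_per \<phi>" by (rule smooth_per_of_antiderivative)
  moreover have "deriv \<phi> = \<psi>" using \<phi> by (auto intro: DERIV_imp_deriv)
  ultimately show thesis by (rule that)
qed

lemma deriv_smooth_per_AC: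
  assumes "smooth_per \<phi>" "z \<in> {c..d}"
  shows "\<phi> z = \<phi> c + (LBINT y:{c..z}. deriv \<phi> y)"
  using assms
  by (intro integral_of_C1) (auto intro: smooth_per_continuous smooth_per_deriv DERIV_subset smooth_per_has_deriv)

text \<open>Constants are admissible test functions on the circle, and their derivative is
  zero.\<close>

lemma weak_deriv_mean_zero:
  assumes "has_weak_deriv_per u g"
  shows "(LBINT z:{-pi..pi}. g z) = 0"
proof -
  have "(LBINT z:{-pi..pi}. u z * deriv (\<lambda>_. 1) z) = - (LBINT z:{-pi..pi}. g z * 1)"
    using assms smooth_per_const[of 1] unfolding has_weak_deriv_per_def by blast
  then show ?thesis by simp
qed

text \<open>The du Bois-Reymond argument. The indefinite integral \<open>U\<close> of
  \<open>g\<close> vanishes at both ends of the period and has the same weak derivative as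
  \<open>u\<close>. Every mean-zero test function is the derivative of a test function, so
  \<open>u - U\<close> is orthogonal to all of them and hence constant almost everywhere.\<close>

lemma weak_deriv_absolutely_continuous:
  assumes u: "u \<in> L2_per" and g: "g \<in> L2_per" and w: "has_weak_deriv_per u g"
  obtains k where "AE z in lborel. z \<in> {-pi..pi} \<longrightarrow> u z = k + (LBINT y:{-pi..z}. g y)"
proof -
  define U where "U z = (LBINT y:{-pi..z}. g y)" for z
  have gI: "set_integrable lborel {-pi..pi} g" by (rule L2_per_integrable[OF g])
  have uI: "set_integrable lborel {-pi..pi} u" by (rule L2_per_integrable[OF u])
  have cU: "continuous_on {-pi..pi} U"
    unfolding U_def by (rule continuous_on_indefinite_integral[OF gI])
  have U0: "U (-pi) = 0" unfolding U_def by (simp add: set_integral_at_point)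
  have U1: "U pi = 0" unfolding U_def by (rule weak_deriv_mean_zero[OF w])
  have UI: "set_integrable lborel {-pi..pi} (\<lambda>z. U z * \<phi> z)" if "smooth_per \<phi>" for \<phi>
    by (intro borel_integrable_atLeastAtMost' continuous_intros cU smooth_per_continuous that)
  have U_int: "set_integrable lborel {-pi..pi} U"
    by (intro borel_integrable_atLeastAtMost' cU)
  have uU: "set_integrable lborel {-pi..pi} (\<lambda>z. u z - U z)"
    by (intro set_integral_diff uI U_int)
  have mult: "(LBINT z:{-pi..pi}. (u z - U z) * \<phi> z)
      = (LBINT z:{-pi..pi}. u z * \<phi> z) - (LBINT z:{-pi..pi}. U z * \<phi> z)"
    "set_integrable lborel {-pi..pi} (\<lambda>z. (u z - U z) * \<phi> z)" if "smooth_per \<phi>" for \<phi>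
    unfolding left_diff_distrib
    by (intro set_integral_diff L2_mult_integrable u smooth_per_L2 UI that)+
  have mean_zero: "(LBINT z:{-pi..pi}. (u z - U z) * \<psi> z) = 0"
    if \<psi>: "smooth_per \<psi>" and 0: "(LBINT z:{-pi..pi}. \<psi> z) = 0" for \<psi>
  proof -
    obtain \<phi> where \<phi>: "smooth_per \<phi>" "deriv \<phi> = \<psi>"
      using smooth_per_antiderivative_exists[OF \<psi> 0] .
    have "(LBINT z:{-pi..pi}. g z * \<phi> z + U z * \<psi> z) = U pi * \<phi> pi - U (-pi) * \<phi> (-pi)"
    proof (rule product_rule_absolutely_continuous)
      show "set_integrable lborel {-pi..pi} \<psi>"
        by (intro borel_integrable_atLeastAtMost' smooth_per_continuous \<psi>)
      show "\<phi> z = \<phi> (-pi) + (LBINT y:{-pi..z}. \<psi> y)" if "z \<in> {-pi..pi}" for z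
        using deriv_smooth_per_AC[OF \<phi>(1) that] \<phi>(2) by simp
      show "U z = U (-pi) + (LBINT y:{-pi..z}. g y)" for z
        unfolding U0 by (simp add: U_def)
    qed (simp_all add: gI)
    moreover have "(LBINT z:{-pi..pi}. g z * \<phi> z + U z * \<psi> z)
        = (LBINT z:{-pi..pi}. g z * \<phi> z) + (LBINT z:{-pi..pi}. U z * \<psi> z)"
      by (intro set_integral_add L2_mult_integrable smooth_per_L2 UI g \<phi> \<psi>)
    moreover have "(LBINT z:{-pi..pi}. u z * \<psi> z) = - (LBINT z:{-pi..pi}. g z * \<phi> z)"
      using w \<phi> unfolding has_weak_deriv_per_def by blast
    ultimately show ?thesis unfolding mult(1)[OF \<psi>] by (simp add: U0 U1)
  qed
  define k where "k = (LBINT z:{-pi..pi}. u z - U z) / (2 * pi)"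
  have c: "(LBINT z:{-pi..pi}. (x::real)) = 2 * pi * x" for x
    by (simp add: set_lebesgue_integral_def)
  have cI: "set_integrable lborel {-pi..pi} (\<lambda>_. x::real)" for x
    by (simp add: set_integrable_def)
  have "AE z in lborel. z \<in> {-pi..pi} \<longrightarrow> (u z - U z) - k = 0"
  proof (rule fundamental_lemma_per)
    show "set_integrable lborel {-pi..pi} (\<lambda>z. (u z - U z) - k)"
      by (intro set_integral_diff uU cI)
    fix \<psi> assume \<psi>: "smooth_per \<psi>"
    have \<psi>I: "set_integrable lborel {-pi..pi} \<psi>" by (intro L2_per_integrable smooth_per_L2 \<psi>)
    \<comment> \<open>Subtracting its mean \<open>m\<close> makes an arbitrary test function
      eligible for \<open>mean_zero\<close>; the mean \<open>k\<close> of \<open>u - U\<close>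
      accounts for the part subtracted.\<close>
    define m where "m = (LBINT z:{-pi..pi}. \<psi> z) / (2 * pi)"
    have "(LBINT z:{-pi..pi}. \<psi> z + (- m)) = 0"
      by (subst set_integral_add(2)[OF \<psi>I cI]) (simp add: c m_def)
    then have "0 = (LBINT z:{-pi..pi}. (u z - U z) * (\<psi> z + (- m)))"
      by (intro mean_zero[symmetric] smooth_per_add_const \<psi>)
    also have "\<dots> = (LBINT z:{-pi..pi}. (u z - U z) * \<psi> z - m * (u z - U z))"
      by (simp add: algebra_simps)
    also have "\<dots> = (LBINT z:{-pi..pi}. (u z - U z) * \<psi> z) - m * (2 * pi * k)"
      by (subst set_integral_diff(2)[OF mult(2)[OF \<psi>] set_integrable_mult_right[OF uU]]) (simp add: k_def)
    also have "\<dots> = (LBINT z:{-pi..pi}. (u z - U z) * \<psi> z) - k * (LBINT z:{-pi..pi}. \<psi> z)"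
      by (simp add: m_def)
    also have "\<dots> = (LBINT z:{-pi..pi}. (u z - U z) * \<psi> z - k * \<psi> z)"
      by (subst set_integral_diff(2)[OF mult(2)[OF \<psi>] set_integrable_mult_right[OF \<psi>I]]) simp
    finally show "(LBINT z:{-pi..pi}. ((u z - U z) - k) * \<psi> z) = 0"
      by (simp only: left_diff_distrib)
  qed
  then have "AE z in lborel. z \<in> {-pi..pi} \<longrightarrow> u z = k + (LBINT y:{-pi..z}. g y)"
    by eventually_elim (auto simp: U_def)
  then show thesis by (rule that)
qed

section \<open>The representative modulo the period and the characteristic speed\<close>

lemma zper_eq: "z \<in> {-pi..<pi} \<Longrightarrow> zper z = z"
  unfolding zper_def by (subst rmod_unique[of "z + pi" _ _ 0]) auto

lemma zper_bounds: "zper z \<in> {-pi..<pi}"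
  using rmod_nonneg[of "2 * pi" "z + pi"] rmod_less[of "2 * pi" "z + pi"] by (auto simp: zper_def)

lemma zper_per: "zper (z + 2 * pi) = zper z"
proof -
  have "(z + 2 * pi + pi) rmod (2 * pi) = (z + pi) rmod (2 * pi)"
  proof -
    have "(z + 2 * pi + pi) / \<bar>2 * pi\<bar> = (z + pi) / \<bar>2 * pi\<bar> + 1" by (simp add: field_simps)
    then have "\<lfloor>(z + 2 * pi + pi) / \<bar>2 * pi\<bar>\<rfloor> = \<lfloor>(z + pi) / \<bar>2 * pi\<bar>\<rfloor> + 1" by simp
    then show ?thesis unfolding rmod_def by (simp add: algebra_simps)
  qed
  then show ?thesis by (simp add: zper_def)
qed

lemma zper_pi: "zper pi = - pi"
  using zper_per[of "-pi"] zper_eq[of "-pi"] by simp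

lemma zper_square: "z \<in> {-pi..pi} \<Longrightarrow> (zper z)\<^sup>2 = z\<^sup>2"
  using zper_eq[of z] zper_pi by (cases "z = pi") auto

lemma zper_measurable [measurable]: "zper \<in> borel_measurable borel"
  unfolding zper_def[abs_def] rmod_def by measurable

text \<open>Minus the weight in \<open>X1_per\<close>, so that the transport term is the derivative
  of \<open>speed * v\<close>. It takes the same value at \<open>- pi\<close> and \<open>pi\<close>,
  hence its periodic continuation is continuous.\<close>

definition speed :: "real \<Rightarrow> real" where
  "speed z = (z\<^sup>2 - pi\<^sup>2) / 6"

lemma speed_boundary [simp]: "speed pi = 0" "speed (-pi) = 0"
  by (simp_all add: speed_def)

text \<open>Formally \<open>2 \<integral> h g = \<integral> a' h\<^sup>2\<close> for \<open>g = (a h)'\<close>, but \<open>a h\<close> is merely absolutely continuous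
  and \<open>a\<close> vanishes at the end points. Integrating by parts against \<open>a / (a\<^sup>2 + \<epsilon>)\<close> instead of
  \<open>1 / a\<close> removes the boundary terms, and \<open>\<epsilon>\<close> then tends to zero.\<close>

lemma transport_energy_bound:
  assumes h: "h \<in> L2_per" and g: "g \<in> L2_per"
    and w: "has_weak_deriv_per (\<lambda>z. speed (zper z) * h z) g" and u: "(\<lambda>z. speed (zper z) * h z) \<in> L2_per"
  shows "\<bar>LBINT z:{-pi..pi}. h z * g z\<bar> \<le> pi / 6 * (L2_norm h)\<^sup>2"
proof -
  have [measurable]: "h \<in> borel_measurable borel" "g \<in> borel_measurable borel"
    using L2_perD(1) h g by auto
  obtain k where k: "AE z in lborel. z \<in> {-pi..pi} \<longrightarrow> speed (zper z) * h z = k + (LBINT y:{-pi..z}. g y)"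
    using weak_deriv_absolutely_continuous[OF u g w] .
  define U where "U z = k + (LBINT y:{-pi..z}. g y)" for z
  have Ueq: "AE z in lborel. z \<in> {-pi..pi} \<longrightarrow> U z = speed z * h z"
    using k by eventually_elim (auto simp: U_def speed_def zper_square)
  have gI: "set_integrable lborel {-pi..pi} g" by (rule L2_per_integrable[OF g])
  have U0: "U (-pi) = k" unfolding U_def by (simp add: set_integral_at_point)
  have Uz: "U z = U (-pi) + (LBINT y:{-pi..z}. g y)" for z unfolding U0 by (simp add: U_def)
  \<comment> \<open>The almost-everywhere derivative of \<open>U * U\<close>, from the product rule
    with both factors equal to \<open>U\<close>.\<close>
  define V' where "V' z = g z * U z + U z * g z" for z
  have V'I: "set_integrable lborel {-pi..pi} V'"
    unfolding V'_def by (rule product_rule_absolutely_continuous(1)) (auto intro: gI Uz)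
  have V: "U z * U z = U (-pi) * U (-pi) + (LBINT y:{-pi..z}. V' y)" if z: "z \<in> {-pi..pi}" for z
  proof -
    have "(LBINT y:{-pi..z}. g y * U y + U y * g y) = U z * U z - U (-pi) * U (-pi)"
      using z by (intro product_rule_absolutely_continuous(2))
        (auto intro: Uz set_integrable_subset[OF gI])
    then show ?thesis by (simp add: V'_def)
  qed
  \<comment> \<open>The weight lies between 0 and 1 and tends to 1 away from the ends of the period
    as \<open>e\<close> tends to zero; multiplied by 2, \<open>P e\<close> is what the term
    \<open>\<eta> * V'\<close> below amounts to.\<close>
  define P where "P e z = (speed z)\<^sup>2 / ((speed z)\<^sup>2 + e) * (h z * g z)" for e z
  have Pabs: "\<bar>P e z\<bar> \<le> \<bar>h z * g z\<bar>" if "0 < e" for e z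
  proof -
    have "0 \<le> (speed z)\<^sup>2 / ((speed z)\<^sup>2 + e)" "(speed z)\<^sup>2 / ((speed z)\<^sup>2 + e) \<le> 1"
      using that by (simp_all add: add_nonneg_pos)
    moreover from this have "\<bar>P e z\<bar> = (speed z)\<^sup>2 / ((speed z)\<^sup>2 + e) * \<bar>h z * g z\<bar>"
      by (simp only: P_def abs_mult abs_of_nonneg)
    ultimately show ?thesis by (simp only:) (rule mult_left_le_one_le, simp_all)
  qed
  have hg: "set_integrable lborel {-pi..pi} (\<lambda>z. h z * g z)"
    by (rule L2_mult_integrable[OF h g])
  have speed_meas [measurable]: "speed \<in> borel_measurable borel"
    unfolding speed_def[abs_def] by measurable
  have bound: "\<bar>LBINT z:{-pi..pi}. P e z\<bar> \<le> pi / 6 * (L2_norm h)\<^sup>2" if e: "0 < e" for e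
  proof -
    define \<eta> where "\<eta> z = speed z / ((speed z)\<^sup>2 + e)" for z
    define \<eta>' where "\<eta>' z = z / 3 * (e - (speed z)\<^sup>2) / ((speed z)\<^sup>2 + e)\<^sup>2" for z
    have pos: "0 < (speed z)\<^sup>2 + e" for z using e by (simp add: add_nonneg_pos)
    have ds: "(speed has_real_derivative z / 3) (at z)" for z
      unfolding speed_def[abs_def] by (auto intro!: derivative_eq_intros)
    have cs: "continuous_on A speed" for A
      unfolding speed_def[abs_def] by (intro continuous_intros) auto
    have d\<eta>: "(\<eta> has_real_derivative \<eta>' z) (at z)" for z
    proof -
      have "(\<eta> has_real_derivative (z / 3 * ((speed z)\<^sup>2 + e) - speed z * (2 * speed z * (z / 3)))
          / (((speed z)\<^sup>2 + e) * ((speed z)\<^sup>2 + e))) (at z)"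
        unfolding \<eta>_def[abs_def] using pos[of z]
        by (auto intro!: derivative_eq_intros ds)
      moreover have "z / 3 * ((speed z)\<^sup>2 + e) - speed z * (2 * speed z * (z / 3)) = z / 3 * (e - (speed z)\<^sup>2)"
        by (simp add: algebra_simps power2_eq_square)
      ultimately show ?thesis by (simp only: \<eta>'_def power2_eq_square)
    qed
    have c\<eta>: "continuous_on {-pi..pi} \<eta>'"
      unfolding \<eta>'_def using pos by (intro continuous_intros cs) (auto simp: less_imp_neq[symmetric])
    have \<eta>z: "\<eta> z = \<eta> (-pi) + (LBINT y:{-pi..z}. \<eta>' y)" if "z \<in> {-pi..pi}" for z
      using that d\<eta> by (intro integral_of_C1[OF _ c\<eta>]) (auto intro: DERIV_subset)
    note \<eta>I = borel_integrable_atLeastAtMost'[OF c\<eta>]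
    have I: "set_integrable lborel {-pi..pi} (\<lambda>z. \<eta>' z * (U z * U z) + \<eta> z * V' z)"
      by (rule product_rule_absolutely_continuous(1)[OF _ \<eta>I V'I \<eta>z V]) auto
    have "(LBINT z:{-pi..pi}. \<eta>' z * (U z * U z) + \<eta> z * V' z)
        = \<eta> pi * (U pi * U pi) - \<eta> (-pi) * (U (-pi) * U (-pi))"
      by (rule product_rule_absolutely_continuous(2)[OF _ \<eta>I V'I \<eta>z V]) auto
    then have 0: "(LBINT z:{-pi..pi}. \<eta>' z * (U z * U z) + \<eta> z * V' z) = 0"
      by (simp add: \<eta>_def)
    \<comment> \<open>Almost everywhere \<open>U = speed * h\<close>, which turns the integrand of
      integral zero into \<open>2 * Q + 2 * P e\<close>. The integral of \<open>P e\<close> is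
      therefore minus that of \<open>Q\<close>, in which \<open>g\<close> no longer occurs.\<close>
    define Q where "Q z = (\<eta>' z * (speed z)\<^sup>2) / 2 * (h z)\<^sup>2" for z
    have \<eta>'_meas [measurable]: "\<eta>' \<in> borel_measurable borel" unfolding \<eta>'_def[abs_def] by measurable
    have Qbound: "\<bar>Q z\<bar> \<le> pi / 6 * (h z)\<^sup>2" if "z \<in> {-pi..pi}" for z
    proof -
      define s where "s = (speed z)\<^sup>2"
      have s: "0 \<le> s" by (simp add: s_def)
      \<comment> \<open>This comparison makes the bound independent of \<open>e\<close>; what is
        left is half the slope \<open>z / 3\<close> of the speed, at most \<open>pi / 6\<close> in
        absolute value.\<close>
      have "\<bar>e - s\<bar> * s \<le> (e + s) * (s + e)"
        using s e by (intro mult_mono) auto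
      then have "\<bar>e - s\<bar> * s / (s + e)\<^sup>2 \<le> 1"
        using s e by (simp add: power2_eq_square add.commute)
      then have "\<bar>z\<bar> / 6 * (\<bar>e - s\<bar> * s / (s + e)\<^sup>2) \<le> pi / 6 * 1"
        using that s by (intro mult_mono) auto
      moreover have "\<bar>\<eta>' z * s / 2\<bar> = \<bar>z\<bar> / 6 * (\<bar>e - s\<bar> * s / (s + e)\<^sup>2)"
        using s by (simp add: \<eta>'_def abs_mult flip: s_def)
      ultimately have "\<bar>\<eta>' z * s / 2\<bar> \<le> pi / 6" by linarith
      then have "\<bar>\<eta>' z * s / 2\<bar> * (h z)\<^sup>2 \<le> pi / 6 * (h z)\<^sup>2"
        by (rule mult_right_mono) simp
      then show ?thesis by (simp add: Q_def abs_mult flip: s_def)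
    qed
    have hI: "set_integrable lborel {-pi..pi} (\<lambda>z. pi / 6 * (h z)\<^sup>2)"
      using L2_perD(3)[OF h] by simp
    have QI: "set_integrable lborel {-pi..pi} Q"
    proof (rule set_integrable_bound[OF hI])
      show "set_borel_measurable lborel {-pi..pi} Q"
        unfolding set_borel_measurable_def Q_def by measurable
      show "AE z in lborel. z \<in> {-pi..pi} \<longrightarrow> norm (Q z) \<le> norm (pi / 6 * (h z)\<^sup>2)"
        using Qbound by (auto intro!: AE_I2)
    qed
    have PI: "set_integrable lborel {-pi..pi} (P e)"
    proof (rule set_integrable_bound[OF hg])
      show "set_borel_measurable lborel {-pi..pi} (P e)"
        unfolding set_borel_measurable_def P_def by measurable
      show "AE z in lborel. z \<in> {-pi..pi} \<longrightarrow> norm (P e z) \<le> norm (h z * g z)"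
        using Pabs[OF e] by (auto intro!: AE_I2)
    qed
    have "(LBINT z:{-pi..pi}. \<eta>' z * (U z * U z) + \<eta> z * V' z) = (LBINT z:{-pi..pi}. 2 * Q z + 2 * P e z)"
      unfolding set_lebesgue_integral_def
    proof (rule integral_cong_AE)
      show "(\<lambda>z. indicator {-pi..pi} z *\<^sub>R (\<eta>' z * (U z * U z) + \<eta> z * V' z)) \<in> borel_measurable lborel"
        using I unfolding set_integrable_def by (rule borel_measurable_integrable)
      show "(\<lambda>z. indicator {-pi..pi} z *\<^sub>R (2 * Q z + 2 * P e z)) \<in> borel_measurable lborel"
        unfolding P_def Q_def by measurable
      show "AE z in lborel. indicator {-pi..pi} z *\<^sub>R (\<eta>' z * (U z * U z) + \<eta> z * V' z)
          = indicator {-pi..pi} z *\<^sub>R (2 * Q z + 2 * P e z)"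
        using Ueq
      proof eventually_elim
        fix z assume "z \<in> {-pi..pi} \<longrightarrow> U z = speed z * h z"
        then show "indicator {-pi..pi} z *\<^sub>R (\<eta>' z * (U z * U z) + \<eta> z * V' z)
          = indicator {-pi..pi} z *\<^sub>R (2 * Q z + 2 * P e z)"
          by (auto simp: indicator_def Q_def P_def \<eta>_def V'_def power2_eq_square)
      qed
    qed
    also have "\<dots> = 2 * (LBINT z:{-pi..pi}. Q z) + 2 * (LBINT z:{-pi..pi}. P e z)"
      using QI PI by (simp add: set_integral_add)
    finally have "(LBINT z:{-pi..pi}. P e z) = - (LBINT z:{-pi..pi}. Q z)"
      using 0 by simp
    then have "\<bar>LBINT z:{-pi..pi}. P e z\<bar> = \<bar>LBINT z:{-pi..pi}. Q z\<bar>" by simp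
    also have "\<dots> \<le> (LBINT z:{-pi..pi}. \<bar>Q z\<bar>)"
      using integral_norm_bound[of lborel "\<lambda>z. indicator {-pi..pi} z *\<^sub>R Q z"]
      by (simp add: set_lebesgue_integral_def abs_mult)
    also have "\<dots> \<le> (LBINT z:{-pi..pi}. pi / 6 * (h z)\<^sup>2)"
      using Qbound by (intro set_integral_mono set_integrable_abs QI hI) auto
    also have "\<dots> = pi / 6 * (L2_norm h)\<^sup>2" using L2_norm_square[OF h] by simp
    finally show ?thesis .
  qed
  have "(\<lambda>n. LBINT z:{-pi..pi}. P (inverse (Suc n)) z) \<longlonglongrightarrow> (LBINT z:{-pi..pi}. h z * g z)"
    unfolding set_lebesgue_integral_def
  proof (rule integral_dominated_convergence)
    show "integrable lborel (\<lambda>z. \<bar>indicator {-pi..pi} z *\<^sub>R (h z * g z)\<bar>)"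
      using hg unfolding set_integrable_def by (rule integrable_abs)
    show "(\<lambda>z. indicator {-pi..pi} z *\<^sub>R P (inverse (Suc n)) z) \<in> borel_measurable lborel" for n
      unfolding P_def by measurable
    show "AE z in lborel. norm (indicator {-pi..pi} z *\<^sub>R P (inverse (Suc n)) z)
        \<le> \<bar>indicator {-pi..pi} z *\<^sub>R (h z * g z)\<bar>" for n
      using Pabs by (auto intro!: AE_I2 simp: indicator_def)
    have "AE z in lborel. z \<noteq> pi \<and> z \<noteq> -pi"
      using AE_lborel_singleton[of pi] AE_lborel_singleton[of "-pi"] by auto
    then show "AE z in lborel. (\<lambda>n. indicator {-pi..pi} z *\<^sub>R P (inverse (Suc n)) z)
        \<longlonglongrightarrow> indicator {-pi..pi} z *\<^sub>R (h z * g z)"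
    proof eventually_elim
      fix z assume z: "z \<noteq> pi \<and> z \<noteq> -pi"
      then have ne: "(speed z)\<^sup>2 \<noteq> 0" using power2_eq_iff[of z pi] by (simp add: speed_def)
      have "(\<lambda>n. (speed z)\<^sup>2 / ((speed z)\<^sup>2 + inverse (real (Suc n)))) \<longlonglongrightarrow> (speed z)\<^sup>2 / ((speed z)\<^sup>2 + 0)"
        using ne by (intro tendsto_intros LIMSEQ_inverse_real_of_nat) auto
      then have "(\<lambda>n. indicator {-pi..pi} z *\<^sub>R P (inverse (Suc n)) z)
          \<longlonglongrightarrow> indicator {-pi..pi} z *\<^sub>R ((speed z)\<^sup>2 / ((speed z)\<^sup>2 + 0) * (h z * g z))"
        unfolding P_def by (intro tendsto_scaleR tendsto_mult tendsto_const)
      then show "(\<lambda>n. indicator {-pi..pi} z *\<^sub>R P (inverse (Suc n)) z)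
        \<longlonglongrightarrow> indicator {-pi..pi} z *\<^sub>R (h z * g z)"
        using ne by simp
    qed
  qed measurable
  then have "(\<lambda>n. \<bar>LBINT z:{-pi..pi}. P (inverse (Suc n)) z\<bar>) \<longlonglongrightarrow> \<bar>LBINT z:{-pi..pi}. h z * g z\<bar>"
    by (rule tendsto_rabs)
  then show ?thesis
    by (rule LIMSEQ_le_const2) (use bound in auto)
qed

subsection \<open>Uniqueness of solutions\<close>

lemma set_integral_combine_Icc:
  fixes f :: "real \<Rightarrow> real"
  assumes "a \<le> b" "b \<le> c" "set_integrable lborel {a..c} f"
  shows "(LBINT y:{a..c}. f y) = (LBINT y:{a..b}. f y) + (LBINT y:{b..c}. f y)"
proof -
  have "AE y in lborel. \<not> (y \<in> {a..b} \<and> y \<in> {b..c})"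
    using AE_lborel_singleton[of b] by eventually_elim auto
  then have "(LBINT y:{a..b} \<union> {b..c}. f y) = (LBINT y:{a..b}. f y) + (LBINT y:{b..c}. f y)"
    using assms by (intro set_integral_Un_AE) (auto intro: set_integrable_subset)
  moreover have "{a..b} \<union> {b..c} = {a..c}" using assms by auto
  ultimately show ?thesis by simp
qed

lemma periodic_shift_int:
  fixes f :: "real \<Rightarrow> 'a"
  assumes "\<And>z. f (z + 2 * pi) = f z"
  shows "f (z + 2 * pi * of_int n) = f z"
proof -
  interpret periodic_fun_simple f "2 * pi" by standard (rule assms)
  show ?thesis using plus_of_int[of z n] by (simp add: mult.commute)
qed

lemma set_integral_periodic_shift:
  fixes f :: "real \<Rightarrow> real"
  assumes per: "\<And>z. f (z + 2 * pi) = f z"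
  shows "set_integrable lborel {a + 2 * pi * of_int n..b + 2 * pi * of_int n} f
      \<longleftrightarrow> set_integrable lborel {a..b} f"
    and "(LBINT y:{a + 2 * pi * of_int n..b + 2 * pi * of_int n}. f y) = (LBINT y:{a..b}. f y)"
proof -
  define s where "s = 2 * pi * of_int n"
  have eq: "indicator {a + s..b + s} (s + 1 * y) *\<^sub>R f (s + 1 * y) = indicator {a..b} y *\<^sub>R f y" for y
    using periodic_shift_int[of f y n, OF per] by (simp add: s_def add.commute indicator_def)
  show "set_integrable lborel {a + 2 * pi * of_int n..b + 2 * pi * of_int n} f
      \<longleftrightarrow> set_integrable lborel {a..b} f"
    unfolding set_integrable_def s_def[symmetric]
    using lborel_integrable_real_affine_iff[of 1 "\<lambda>y. indicator {a + s..b + s} y *\<^sub>R f y" s]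
    by (simp only: eq)
  show "(LBINT y:{a + 2 * pi * of_int n..b + 2 * pi * of_int n}. f y) = (LBINT y:{a..b}. f y)"
    unfolding set_lebesgue_integral_def s_def[symmetric]
    using lborel_integral_real_affine[of 1 "\<lambda>y. indicator {a + s..b + s} y *\<^sub>R f y" s]
    by (simp only: eq abs_one scaleR_one)
qed

lemma periodic_zper:
  fixes f :: "real \<Rightarrow> 'a"
  assumes per: "\<And>z. f (z + 2 * pi) = f z"
  shows "f (zper z) = f z"
proof -
  obtain k where "-pi + 2 * pi * of_int k \<le> z" "z < pi + 2 * pi * of_int k"
    using period_index .
  then have k: "z - 2 * pi * of_int k \<in> {-pi..<pi}" by auto
  have "zper z = zper (z - 2 * pi * of_int k)"
    using periodic_shift_int[of zper "z - 2 * pi * of_int k" k, OF zper_per] by simp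
  then have "zper z = z - 2 * pi * of_int k" using zper_eq[OF k] by simp
  then show ?thesis
    using periodic_shift_int[of f "z - 2 * pi * of_int k" k, OF per] by simp
qed

text \<open>A bounded interval is covered by finitely many translates of the standard
  period.\<close>

lemma L2_per_locally_integrable:
  assumes v: "v \<in> L2_per"
  shows "set_integrable lborel {a..b} v"
proof -
  obtain j where j: "-pi + 2 * pi * of_int j \<le> a" using period_index .
  obtain k where k: "b < pi + 2 * pi * of_int k" using period_index .
  have int: "set_integrable lborel (\<Union>n\<in>{j..k}. {-pi + 2 * pi * of_int n..pi + 2 * pi * of_int n}) v"
    by (intro set_integrable_UN)
      (simp_all only: set_integral_periodic_shift(1)[of v, OF L2_perD(2)[OF v]] L2_per_integrable[OF v]
        finite_atLeastAtMost_int sets_lborel atLeastAtMost_borel)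
  have sub: "{a..b} \<subseteq> (\<Union>n\<in>{j..k}. {-pi + 2 * pi * of_int n..pi + 2 * pi * of_int n})"
  proof
    fix z assume z: "z \<in> {a..b}"
    obtain n where n: "-pi + 2 * pi * of_int n \<le> z" "z < pi + 2 * pi * of_int n"
      using period_index .
    have "2 * pi * of_int j < 2 * pi * (of_int n + 1)" "2 * pi * of_int n < 2 * pi * (of_int k + 1)"
      using j k n z by (auto simp: algebra_simps)
    then have "real_of_int j < of_int n + 1" "real_of_int n < of_int k + 1"
      by (simp_all only: mult_less_cancel_left_pos[of "2 * pi"] pi_gt_zero zero_less_mult_iff zero_less_numeral simp_thms)
    then have "j \<le> n" "n \<le> k" by linarith+
    then show "z \<in> (\<Union>n\<in>{j..k}. {-pi + 2 * pi * of_int n..pi + 2 * pi * of_int n})"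
      using n by fastforce
  qed
  show ?thesis by (rule set_integrable_subset[OF int _ sub]) simp
qed

text \<open>The interval contains the end point \<open>pi + 2 * pi * of_int k\<close> of a standard
  period; cutting there and moving the right-hand piece back by \<open>2 * pi\<close> completes that
  period.\<close>

lemma set_integral_any_period:
  assumes v: "v \<in> L2_per"
  shows "(LBINT y:{z..z + 2 * pi}. v y) = (LBINT y:{-pi..pi}. v y)"
proof -
  note shift = set_integral_periodic_shift(2)[of v, OF L2_perD(2)[OF v]]
  note int = L2_per_locally_integrable[OF v]
  obtain k where k: "-pi + 2 * pi * of_int k \<le> z" "z < pi + 2 * pi * of_int k"
    using period_index .
  have "(LBINT y:{z..z + 2 * pi}. v y) = (LBINT y:{z..pi + 2 * pi * of_int k}. v y)
      + (LBINT y:{pi + 2 * pi * of_int k..z + 2 * pi}. v y)"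
    using k int by (intro set_integral_combine_Icc) auto
  also have "(LBINT y:{pi + 2 * pi * of_int k..z + 2 * pi}. v y) = (LBINT y:{-pi + 2 * pi * of_int k..z}. v y)"
    using shift[of "-pi + 2 * pi * of_int k" 1 z] by (simp add: algebra_simps)
  also have "(LBINT y:{z..pi + 2 * pi * of_int k}. v y) + (LBINT y:{-pi + 2 * pi * of_int k..z}. v y)
      = (LBINT y:{-pi + 2 * pi * of_int k..pi + 2 * pi * of_int k}. v y)"
    using k int set_integral_combine_Icc[of "-pi + 2 * pi * of_int k" z "pi + 2 * pi * of_int k" v] by simp
  also have "\<dots> = (LBINT y:{-pi..pi}. v y)" by (rule shift)
  finally show ?thesis .
qed

lemma L2_per_zper:
  assumes cont: "continuous_on {-pi..pi} f"
  shows "(\<lambda>z. f (zper z)) \<in> L2_per"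
proof -
  have [measurable]: "(\<lambda>z. indicator {-pi..pi} z *\<^sub>R f z) \<in> borel_measurable borel"
    by (rule borel_measurable_continuous_on_indicator[OF _ cont]) simp
  have "(\<lambda>z. f (zper z)) = (\<lambda>z. indicator {-pi..pi} (zper z) *\<^sub>R f (zper z))"
    using zper_bounds by (auto simp: indicator_def fun_eq_iff less_imp_le)
  also have "\<dots> \<in> borel_measurable borel"
    by (rule measurable_compose[OF zper_measurable]) measurable
  finally have meas: "(\<lambda>z. f (zper z)) \<in> borel_measurable borel" .
  obtain B where B: "\<And>z. z \<in> {-pi..pi} \<Longrightarrow> \<bar>f z\<bar> \<le> B"
    using compact_imp_bounded[OF compact_continuous_image[OF cont compact_Icc]]
    by (fastforce simp: bounded_iff)
  show ?thesis
  proof (rule L2_per_bounded[OF meas])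
    show "f (zper (z + 2 * pi)) = f (zper z)" for z by (simp add: zper_per)
    show "\<bar>f (zper z)\<bar> \<le> B" for z using zper_bounds[of z] by (intro B) auto
  qed
qed

lemma L2_per_continuous_period:
  assumes cont: "continuous_on {-pi..pi} f" and per: "\<And>z. f (z + 2 * pi) = f z"
  shows "f \<in> L2_per"
  using L2_per_zper[OF cont] by (simp add: periodic_zper[of f, OF per])

section \<open>The zero-mean antiderivative\<close>

lemma mean_zero_antiderivative_unique:
  fixes v W1 W2 :: "real \<Rightarrow> real"
  assumes v: "set_integrable lborel {-pi..pi} v"
    and W1: "\<And>z. z \<in> {-pi..pi} \<Longrightarrow> W1 z = W1 (-pi) + (LBINT y:{-pi..z}. v y)"
    and W2: "\<And>z. z \<in> {-pi..pi} \<Longrightarrow> W2 z = W2 (-pi) + (LBINT y:{-pi..z}. v y)"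
    and "(LBINT z:{-pi..pi}. W1 z) = 0" "(LBINT z:{-pi..pi}. W2 z) = 0"
    and z: "z \<in> {-pi..pi}"
  shows "W1 z = W2 z"
proof -
  have int: "set_integrable lborel {-pi..pi} W"
    if "\<And>z. z \<in> {-pi..pi} \<Longrightarrow> W z = W (-pi) + (LBINT y:{-pi..z}. v y)" for W :: "real \<Rightarrow> real"
  proof (rule borel_integrable_atLeastAtMost')
    have "continuous_on {-pi..pi} (\<lambda>z. W (-pi) + (LBINT y:{-pi..z}. v y))"
      by (rule continuous_on_add[OF continuous_on_const continuous_on_indefinite_integral[OF v]])
    then show "continuous_on {-pi..pi} W"
      by (rule continuous_on_eq) (rule that[symmetric])
  qed
  have diff: "W1 z - W2 z = W1 (-pi) - W2 (-pi)" if "z \<in> {-pi..pi}" for z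
    using W1[OF that] W2[OF that] by simp
  have "0 = (LBINT z:{-pi..pi}. W1 z) - (LBINT z:{-pi..pi}. W2 z)" using assms by simp
  also have "\<dots> = (LBINT z:{-pi..pi}. W1 z - W2 z)"
    by (rule set_integral_diff(2)[OF int[of W1, OF W1] int[of W2, OF W2], symmetric])
  also have "\<dots> = (LBINT z:{-pi..pi}. W1 (-pi) - W2 (-pi))"
    by (rule set_lebesgue_integral_cong) (simp, intro allI impI, rule diff)
  also have "\<dots> = 2 * pi * (W1 (-pi) - W2 (-pi))"
    by (simp add: set_lebesgue_integral_def)
  finally show ?thesis using diff[OF z] by simp
qed

text \<open>Justifies the definite description in \<open>dz_inv\<close>. The zero mean of
  \<open>v\<close> makes its antiderivatives periodic, and the normalization of \<open>w\<close>
  fixes the additive constant.\<close>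

lemma dz_inv_exists:
  assumes v: "v \<in> L2_dot_per"
  shows "\<exists>!w. periodic_fun_simple w (2 * pi) \<and> (\<forall>a b. a \<le> b \<longrightarrow> w b - w a = (LBINT z:{a..b}. v z)) \<and>
    (LBINT z:{-pi..pi}. w z) = 0"
proof -
  have v2: "v \<in> L2_per" and v0: "(LBINT z:{-pi..pi}. v z) = 0" using v by (auto simp: L2_dot_per_def)
  note int = L2_per_locally_integrable[OF v2]
  \<comment> \<open>The signed integral from 0 to \<open>z\<close>: a set integral over a reversed
    interval is zero, so at most one summand counts.\<close>
  define V where "V z = (LBINT y:{0..z}. v y) - (LBINT y:{z..0}. v y)" for z
  have emp: "(LBINT y:{a..b}. v y) = 0" if "b \<le> a" for a b
  proof (cases "a = b")
    case True
    then show ?thesis by (simp add: set_integral_at_point)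
  next
    case False
    then show ?thesis using that by (simp add: set_lebesgue_integral_def)
  qed
  have V: "V b - V a = (LBINT z:{a..b}. v z)" if "a \<le> b" for a b
  proof -
    consider "0 \<le> a" | "a \<le> 0" "0 \<le> b" | "b \<le> 0" by linarith
    then show ?thesis
    proof cases
      case 1
      then show ?thesis using that set_integral_combine_Icc[of 0 a b v] int by (simp add: V_def emp)
    next
      case 2
      then show ?thesis using that set_integral_combine_Icc[of a 0 b v] int by (simp add: V_def emp)
    next
      case 3
      then show ?thesis using that set_integral_combine_Icc[of a b 0 v] int by (simp add: V_def emp)
    qed
  qed
  have Vper: "V (z + 2 * pi) = V z" for z
    using V[of z "z + 2 * pi"] set_integral_any_period[OF v2, of z] v0 by simp
  have Vz: "V z = V (-pi) + (LBINT y:{-pi..z}. v y)" if "z \<in> {-pi..pi}" for z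
    using V[of "-pi" z] that by simp
  have "continuous_on {-pi..pi} (\<lambda>z. V (-pi) + (LBINT y:{-pi..z}. v y))"
    by (rule continuous_on_add[OF continuous_on_const continuous_on_indefinite_integral[OF int]])
  then have "continuous_on {-pi..pi} V" by (rule continuous_on_eq) (rule Vz[symmetric])
  then have VI: "set_integrable lborel {-pi..pi} V" by (rule borel_integrable_atLeastAtMost')
  define m where "m = (LBINT z:{-pi..pi}. V z) / (2 * pi)"
  have cI: "set_integrable lborel {-pi..pi} (\<lambda>_. m)" by (simp add: set_integrable_def)
  have mean: "(LBINT z:{-pi..pi}. V z - m) = 0"
    unfolding set_integral_diff(2)[OF VI cI] by (simp add: set_lebesgue_integral_def m_def)
  show ?thesis
  proof (rule ex1I[of _ "\<lambda>z. V z - m"], safe)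
    show "periodic_fun_simple (\<lambda>z. V z - m) (2 * pi)" by standard (simp add: Vper)
    fix a b :: real assume "a \<le> b"
    then show "V b - m - (V a - m) = (LBINT z:{a..b}. v z)" using V by simp
  next
    fix w assume per: "periodic_fun_simple w (2 * pi)"
      and w: "\<forall>a b. a \<le> b \<longrightarrow> w b - w a = (LBINT z:{a..b}. v z)" and w0: "(LBINT z:{-pi..pi}. w z) = 0"
    have eq: "w z = V z - m" if "z \<in> {-pi..pi}" for z
    proof (rule mean_zero_antiderivative_unique[OF int _ _ w0 mean that])
      show "w z = w (-pi) + (LBINT y:{-pi..z}. v y)" if "z \<in> {-pi..pi}" for z
        using w[rule_format, of "-pi" z] that by simp
      show "V z - m = V (-pi) - m + (LBINT y:{-pi..z}. v y)" if "z \<in> {-pi..pi}" for z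
        using Vz[OF that] by simp
    qed
    show "w = (\<lambda>z. V z - m)"
    proof
      fix z
      have "w z = w (zper z)"
        using per periodic_zper[of w z] by (simp add: periodic_fun_simple_def)
      also have "\<dots> = V (zper z) - m" using zper_bounds[of z] by (intro eq) auto
      also have "\<dots> = V z - m" using periodic_zper[of V z, OF Vper] by simp
      finally show "w z = V z - m" .
    qed
  qed (rule mean)
qed

lemma dz_inv_props:
  assumes "v \<in> L2_dot_per"
  shows "dz_inv v (z + 2 * pi) = dz_inv v z"
    and "z \<in> {-pi..pi} \<Longrightarrow> dz_inv v z = dz_inv v (-pi) + (LBINT y:{-pi..z}. v y)"
    and "(LBINT z:{-pi..pi}. dz_inv v z) = 0"
proof -
  have *: "periodic_fun_simple (dz_inv v) (2 * pi)"
    "\<forall>a b. a \<le> b \<longrightarrow> dz_inv v b - dz_inv v a = (LBINT z:{a..b}. v z)"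
    "(LBINT z:{-pi..pi}. dz_inv v z) = 0"
    using theI'[OF dz_inv_exists[OF assms]] unfolding dz_inv_def by blast+
  show "dz_inv v (z + 2 * pi) = dz_inv v z"
    using *(1) by (simp add: periodic_fun_simple_def)
  show "z \<in> {-pi..pi} \<Longrightarrow> dz_inv v z = dz_inv v (-pi) + (LBINT y:{-pi..z}. v y)"
    using *(2)[rule_format, of "-pi" z] by simp
  show "(LBINT z:{-pi..pi}. dz_inv v z) = 0" by (rule *)
qed

lemma dz_inv_continuous:
  assumes v: "v \<in> L2_dot_per"
  shows "continuous_on {-pi..pi} (dz_inv v)"
proof -
  have "v \<in> L2_per" using v by (auto simp: L2_dot_per_def)
  then have "continuous_on {-pi..pi} (\<lambda>z. dz_inv v (-pi) + (LBINT y:{-pi..z}. v y))"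
    by (intro continuous_on_add continuous_on_const continuous_on_indefinite_integral L2_per_integrable)
  then show ?thesis
    by (rule continuous_on_eq) (rule dz_inv_props(2)[OF v, symmetric])
qed

lemma dz_inv_L2: "v \<in> L2_dot_per \<Longrightarrow> dz_inv v \<in> L2_per"
  by (intro L2_per_continuous_period dz_inv_continuous dz_inv_props)

lemma dz_inv_eqI:
  assumes v: "v \<in> L2_dot_per"
    and "\<And>z. z \<in> {-pi..pi} \<Longrightarrow> W z = W (-pi) + (LBINT y:{-pi..z}. v y)"
    and "(LBINT z:{-pi..pi}. W z) = 0" "z \<in> {-pi..pi}"
  shows "dz_inv v z = W z"
  by (rule mean_zero_antiderivative_unique[of v "dz_inv v" W, OF _ dz_inv_props(2)[OF v] assms(2)
        dz_inv_props(3)[OF v] assms(3,4)])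
    (use v in \<open>auto simp: L2_dot_per_def L2_per_integrable\<close>)

section \<open>The energy method\<close>

lemma L2_norm_square_has_derivative:
  assumes h: "\<And>s. h s \<in> L2_per" and u: "u \<in> L2_per"
    and lim: "((\<lambda>k. L2_norm (\<lambda>z. (h (t + k) z - h t z) / k - u z)) \<longlongrightarrow> 0) (at 0)"
  shows "((\<lambda>s. (L2_norm (h s))\<^sup>2) has_real_derivative 2 * (LBINT z:{-pi..pi}. h t z * u z)) (at t)"
proof -
  define r where "r k z = (h (t + k) z - h t z) / k - u z" for k z
  have r: "r k \<in> L2_per" for k
  proof -
    \<comment> \<open>Division by zero gives zero, so the case \<open>k = 0\<close> is
      included.\<close>
    have "(\<lambda>z. inverse k * (h (t + k) z - h t z) - u z) \<in> L2_per"
      by (intro L2_per_diff L2_per_cmult h u)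
    then show ?thesis by (simp add: r_def[abs_def] divide_inverse mult.commute)
  qed
  define B where "B k = 2 * (L2_norm (h t) * L2_norm (r k)) + \<bar>k\<bar> * (L2_norm u + L2_norm (r k))\<^sup>2" for k
  have rlim: "((\<lambda>k. L2_norm (r k)) \<longlongrightarrow> 0) (at 0)" using lim by (simp add: r_def[abs_def])
  have "((\<lambda>k. 2 * (L2_norm (h t) * L2_norm (r k)) + \<bar>k\<bar> * (L2_norm u + L2_norm (r k))\<^sup>2)
      \<longlongrightarrow> 2 * (L2_norm (h t) * 0) + \<bar>0\<bar> * (L2_norm u + 0)\<^sup>2) (at 0)"
    by (intro tendsto_intros rlim)
  then have B: "(B \<longlongrightarrow> 0) (at 0)" by (simp add: B_def[abs_def])
  have bound: "norm (((L2_norm (h (t + k)))\<^sup>2 - (L2_norm (h t))\<^sup>2) / k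
      - 2 * (LBINT z:{-pi..pi}. h t z * u z)) \<le> B k" if k: "k \<noteq> 0" for k
  proof -
    \<comment> \<open>\<open>q\<close> is the difference quotient. Expanding the square of
      \<open>h t + k * q\<close> leaves the claimed derivative plus terms that Cauchy-Schwarz and
      the triangle inequality bound by \<open>B k\<close>.\<close>
    define q where "q z = u z + r k z" for z
    have q: "q \<in> L2_per" unfolding q_def[abs_def] by (intro L2_per_add u r)
    have hk: "h (t + k) z = h t z + k * q z" for z
      using k by (simp add: q_def r_def)
    have 1: "set_integrable lborel {-pi..pi} (\<lambda>z. (h t z)\<^sup>2)" "set_integrable lborel {-pi..pi} (\<lambda>z. (q z)\<^sup>2)"
      "set_integrable lborel {-pi..pi} (\<lambda>z. h t z * q z)"
      using L2_perD(3)[OF h] L2_perD(3)[OF q] L2_mult_integrable[OF h q] by auto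
    have "(L2_norm (h (t + k)))\<^sup>2 = (LBINT z:{-pi..pi}. (h t z)\<^sup>2 + ((2 * k) * (h t z * q z) + k\<^sup>2 * (q z)\<^sup>2))"
      unfolding L2_norm_square[OF h] hk by (simp add: power2_eq_square algebra_simps)
    also have "\<dots> = (L2_norm (h t))\<^sup>2 + ((2 * k) * (LBINT z:{-pi..pi}. h t z * q z) + k\<^sup>2 * (L2_norm q)\<^sup>2)"
      using 1 by (simp add: set_integral_add L2_norm_square[OF h] L2_norm_square[OF q])
    finally have e1: "((L2_norm (h (t + k)))\<^sup>2 - (L2_norm (h t))\<^sup>2) / k
        = 2 * (LBINT z:{-pi..pi}. h t z * q z) + k * (L2_norm q)\<^sup>2"
      using k by (simp add: power2_eq_square field_simps)
    have e2: "(LBINT z:{-pi..pi}. h t z * q z)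
        = (LBINT z:{-pi..pi}. h t z * u z) + (LBINT z:{-pi..pi}. h t z * r k z)"
      unfolding q_def distrib_left by (intro set_integral_add L2_mult_integrable h u r)
    have "norm (((L2_norm (h (t + k)))\<^sup>2 - (L2_norm (h t))\<^sup>2) / k
      - 2 * (LBINT z:{-pi..pi}. h t z * u z)) = \<bar>2 * (LBINT z:{-pi..pi}. h t z * r k z) + k * (L2_norm q)\<^sup>2\<bar>"
      unfolding e1 e2 by simp
    also have "\<dots> \<le> 2 * \<bar>LBINT z:{-pi..pi}. h t z * r k z\<bar> + \<bar>k\<bar> * (L2_norm q)\<^sup>2"
      by (rule order_trans[OF abs_triangle_ineq]) (simp add: abs_mult)
    also have "\<dots> \<le> B k"
      unfolding B_def
    proof (intro add_mono mult_left_mono power_mono)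
      show "\<bar>LBINT z:{-pi..pi}. h t z * r k z\<bar> \<le> L2_norm (h t) * L2_norm (r k)"
        by (rule L2_Cauchy_Schwarz[OF h r])
      show "L2_norm q \<le> L2_norm u + L2_norm (r k)"
        unfolding q_def[abs_def] by (rule L2_norm_triangle[OF u r])
    qed auto
    finally show ?thesis .
  qed
  have "((\<lambda>k. ((L2_norm (h (t + k)))\<^sup>2 - (L2_norm (h t))\<^sup>2) / k
      - 2 * (LBINT z:{-pi..pi}. h t z * u z)) \<longlongrightarrow> 0) (at 0)"
    by (rule Lim_null_comparison[OF eventually_mono[OF eventually_neq_at_within] B]) (rule bound)
  then show ?thesis unfolding DERIV_def by (subst (asm) LIM_zero_iff)
qed

text \<open>The integrating factor \<open>exp (- c * t)\<close> makes the product with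
  \<open>N\<close> nonincreasing, which settles \<open>0 \<le> t\<close>; \<open>exp (c * t)\<close>
  makes it nondecreasing, which settles \<open>t \<le> 0\<close>. The bound on the absolute value of
  \<open>N'\<close> supplies both.\<close>

lemma Gronwall_zero:
  fixes N :: "real \<Rightarrow> real"
  assumes N: "\<And>t. (N has_real_derivative N' t) (at t)" and bound: "\<And>t. \<bar>N' t\<bar> \<le> c * N t"
    and nonneg: "\<And>t. 0 \<le> N t" and 0: "N 0 = 0"
  shows "N t = 0"
proof (cases "0 \<le> t")
  case True
  have "exp (- c * t) * N t \<le> exp (- c * 0) * N 0"
  proof (rule DERIV_nonpos_imp_nonincreasing[OF True])
    fix x :: real
    have "((\<lambda>t. exp (- c * t) * N t) has_real_derivative exp (- c * x) * (N' x - c * N x)) (at x)"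
      by (auto intro!: derivative_eq_intros N simp: algebra_simps)
    moreover have "exp (- c * x) * (N' x - c * N x) \<le> 0"
      using bound[of x] by (intro mult_nonneg_nonpos) auto
    ultimately show "\<exists>y. ((\<lambda>t. exp (- c * t) * N t) has_real_derivative y) (at x) \<and> y \<le> 0" by blast
  qed
  then show ?thesis using 0 nonneg[of t] by (simp add: mult_le_0_iff)
next
  case False
  then have "t \<le> 0" by simp
  have "exp (c * t) * N t \<le> exp (c * 0) * N 0"
  proof (rule DERIV_nonneg_imp_nondecreasing[OF \<open>t \<le> 0\<close>])
    fix x :: real
    have "((\<lambda>t. exp (c * t) * N t) has_real_derivative exp (c * x) * (N' x + c * N x)) (at x)"
      by (auto intro!: derivative_eq_intros N simp: algebra_simps)
    moreover have "0 \<le> exp (c * x) * (N' x + c * N x)"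
      using bound[of x] by (intro mult_nonneg_nonneg) auto
    ultimately show "\<exists>y. ((\<lambda>t. exp (c * t) * N t) has_real_derivative y) (at x) \<and> 0 \<le> y" by blast
  qed
  then show ?thesis using 0 nonneg[of t] by (simp add: mult_le_0_iff)
qed

lemma X1_perD:
  assumes "v \<in> X1_per"
  shows "v \<in> L2_dot_per" "v \<in> L2_per" "(\<lambda>z. speed (zper z) * v z) \<in> H1_per"
    "(\<lambda>z. speed (zper z) * v z) \<in> L2_per"
proof -
  show "v \<in> L2_dot_per" "v \<in> L2_per" using assms by (auto simp: X1_per_def L2_dot_per_def)
  define f where "f = (\<lambda>z. 1/6 * (pi\<^sup>2 - (zper z)\<^sup>2) * v z)"
  have f: "f \<in> H1_per" using assms by (simp add: X1_per_def f_def)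
  have eq: "(\<lambda>z. speed (zper z) * v z) = (\<lambda>z. (-1) * f z)"
    by (simp add: f_def speed_def fun_eq_iff field_simps)
  from f obtain g where "f \<in> L2_per" "g \<in> L2_per" "has_weak_deriv_per f g" by (auto simp: H1_per_def)
  then have "(\<lambda>z. (-1) * f z) \<in> L2_per" "(\<lambda>z. (-1) * g z) \<in> L2_per"
    "has_weak_deriv_per (\<lambda>z. (-1) * f z) (\<lambda>z. (-1) * g z)"
    by (simp_all only: L2_per_cmult has_weak_deriv_per_cmult)
  then show "(\<lambda>z. speed (zper z) * v z) \<in> H1_per" "(\<lambda>z. speed (zper z) * v z) \<in> L2_per"
    unfolding eq by (auto simp: H1_per_def simp del: mult_minus1)
qed

text \<open>With \<open>K\<close> the difference of the antiderivatives, the integrand is half the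
  derivative of \<open>K * K\<close>, and \<open>K\<close> is periodic. The two antiderivatives are
  kept apart because subtracting two equations delivers them in this form.\<close>

lemma dz_inv_diff_orthogonal:
  assumes w: "w \<in> L2_dot_per" and v: "v \<in> L2_dot_per"
  shows "(LBINT z:{-pi..pi}. (w z - v z) * (dz_inv w z - dz_inv v z)) = 0"
proof -
  have int: "set_integrable lborel {a..b} w" "set_integrable lborel {a..b} v" for a b
    using v w by (auto intro: L2_per_locally_integrable simp: L2_dot_per_def)
  define K where "K z = dz_inv w z - dz_inv v z" for z
  have K: "K z = K (-pi) + (LBINT y:{-pi..z}. w y - v y)" if "z \<in> {-pi..pi}" for z
    using dz_inv_props(2)[OF w that] dz_inv_props(2)[OF v that]
    by (simp add: K_def set_integral_diff(2)[OF int])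
  have "(LBINT z:{-pi..pi}. (w z - v z) * K z + K z * (w z - v z)) = K pi * K pi - K (-pi) * K (-pi)"
    by (rule product_rule_absolutely_continuous(2)) (auto intro: K int)
  also have "K pi = K (-pi)"
    using dz_inv_props(1)[OF w, of "-pi"] dz_inv_props(1)[OF v, of "-pi"] by (simp add: K_def)
  finally have "(LBINT z:{-pi..pi}. 2 * ((w z - v z) * K z)) = 0" by (simp add: algebra_simps)
  then show ?thesis by (simp add: K_def)
qed

lemma global_solution_unique:
  assumes w: "is_global_solution v0 w" and v: "is_global_solution v0 v"
  shows "AE z in lborel. w t z = v t z"
proof -
  define h where "h s z = w s z - v s z" for s z
  have wX: "w s \<in> X1_per" and vX: "v s \<in> X1_per" for s
    using w v by (auto simp: is_global_solution_def continuous_X1_def)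
  note wD = X1_perD[OF wX] and vD = X1_perD[OF vX]
  have h: "h s \<in> L2_per" for s
    unfolding h_def[abs_def] by (intro L2_per_diff wD vD)
  have "\<exists>D. ((\<lambda>s. (L2_norm (h s))\<^sup>2) has_real_derivative D) (at s) \<and> \<bar>D\<bar> \<le> pi / 3 * (L2_norm (h s))\<^sup>2" for s
  proof -
    have eq: "(\<lambda>y. 1/6 * ((zper y)\<^sup>2 - pi\<^sup>2) * f y) = (\<lambda>z. speed (zper z) * f z)" for f
      by (auto simp: speed_def)
    obtain w' where w': "has_L2_time_deriv w w' s"
      "AE z in lborel. w' z + dz (\<lambda>z. speed (zper z) * w s z) z = dz_inv (w s) z"
      using w unfolding is_global_solution_def eq by blast
    obtain v' where v': "has_L2_time_deriv v v' s"
      "AE z in lborel. v' z + dz (\<lambda>z. speed (zper z) * v s z) z = dz_inv (v s) z"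
      using v unfolding is_global_solution_def eq by blast
    have w'2: "w' \<in> L2_per" and v'2: "v' \<in> L2_per"
      using w' v' by (auto simp: has_L2_time_deriv_def L2_dot_per_def)
    define u where "u z = w' z - v' z" for z
    have u: "u \<in> L2_per" unfolding u_def[abs_def] by (intro L2_per_diff w'2 v'2)
    \<comment> \<open>\<open>dz\<close> picks an arbitrary weak derivative, so \<open>g\<close> is
      the difference of two picks; linearity makes it a weak derivative of \<open>speed * h\<close>,
      as the energy bound requires.\<close>
    define g where "g z = dz (\<lambda>z. speed (zper z) * w s z) z - dz (\<lambda>z. speed (zper z) * v s z) z" for z
    have g: "g \<in> L2_per" unfolding g_def[abs_def] by (intro L2_per_diff dz_of_H1 wD vD)
    have sh: "(\<lambda>z. speed (zper z) * h s z) = (\<lambda>z. speed (zper z) * w s z - speed (zper z) * v s z)"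
      by (simp add: h_def algebra_simps)
    have wg: "has_weak_deriv_per (\<lambda>z. speed (zper z) * h s z) g"
      unfolding sh g_def[abs_def] by (intro has_weak_deriv_per_diff dz_of_H1 wD vD)
    have "(\<lambda>z. speed (zper z) * h s z) \<in> L2_per"
      unfolding sh by (intro L2_per_diff wD vD)
    then have bound: "\<bar>LBINT z:{-pi..pi}. h s z * g z\<bar> \<le> pi / 6 * (L2_norm (h s))\<^sup>2"
      by (rule transport_energy_bound[OF h g wg])
    define K where "K z = dz_inv (w s) z - dz_inv (v s) z" for z
    have K: "K \<in> L2_per" unfolding K_def[abs_def] by (intro L2_per_diff dz_inv_L2 wD vD)
    have "(LBINT z:{-pi..pi}. h s z * u z) = (LBINT z:{-pi..pi}. h s z * K z - h s z * g z)"
    proof (rule set_lebesgue_integral_cong_AE)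
      show "AE z in lborel. z \<in> {-pi..pi} \<longrightarrow> h s z * u z = h s z * K z - h s z * g z"
        using w'(2) v'(2)
      proof eventually_elim
        fix z assume "w' z + dz (\<lambda>z. speed (zper z) * w s z) z = dz_inv (w s) z"
          "v' z + dz (\<lambda>z. speed (zper z) * v s z) z = dz_inv (v s) z"
        then have "u z = K z - g z" by (simp add: u_def K_def g_def)
        then show "z \<in> {-pi..pi} \<longrightarrow> h s z * u z = h s z * K z - h s z * g z"
          by (simp only: right_diff_distrib simp_thms)
      qed
    qed (use L2_perD(1)[OF h] L2_perD(1)[OF u] L2_perD(1)[OF K] L2_perD(1)[OF g] in measurable)
    also have "\<dots> = (LBINT z:{-pi..pi}. h s z * K z) - (LBINT z:{-pi..pi}. h s z * g z)"
      by (intro set_integral_diff L2_mult_integrable h K g)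
    also have "(LBINT z:{-pi..pi}. h s z * K z) = 0"
      using dz_inv_diff_orthogonal[OF wD(1) vD(1)] by (simp add: h_def K_def)
    finally have "\<bar>2 * (LBINT z:{-pi..pi}. h s z * u z)\<bar> \<le> pi / 3 * (L2_norm (h s))\<^sup>2"
      using bound by (simp add: abs_mult)
    moreover have "((\<lambda>s. (L2_norm (h s))\<^sup>2) has_real_derivative 2 * (LBINT z:{-pi..pi}. h s z * u z)) (at s)"
    proof (rule L2_norm_square_has_derivative[OF h u])
      define rw where "rw k z = (w (s + k) z - w s z) / k - w' z" for k z
      define rv where "rv k z = (v (s + k) z - v s z) / k - v' z" for k z
      have r: "rw k \<in> L2_per" "rv k \<in> L2_per" for k
      proof -
        have "(\<lambda>z. inverse k * (w (s + k) z - w s z) - w' z) \<in> L2_per"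
          "(\<lambda>z. inverse k * (v (s + k) z - v s z) - v' z) \<in> L2_per"
          by (intro L2_per_diff L2_per_cmult wD vD w'2 v'2)+
        then show "rw k \<in> L2_per" "rv k \<in> L2_per"
          by (simp_all add: rw_def[abs_def] rv_def[abs_def] divide_inverse mult.commute)
      qed
      have lim: "((\<lambda>k. L2_norm (rw k) + \<bar>-1\<bar> * L2_norm (rv k)) \<longlongrightarrow> 0 + \<bar>-1\<bar> * 0) (at 0)"
        using w'(1) v'(1) unfolding has_L2_time_deriv_def rw_def[abs_def] rv_def[abs_def]
        by (intro tendsto_intros) auto
      show "((\<lambda>k. L2_norm (\<lambda>z. (h (s + k) z - h s z) / k - u z)) \<longlongrightarrow> 0) (at 0)"
      proof (rule Lim_null_comparison)
        show "((\<lambda>k. L2_norm (rw k) + \<bar>-1\<bar> * L2_norm (rv k)) \<longlongrightarrow> 0) (at 0)" using lim by simp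
        have "(\<lambda>z. (h (s + k) z - h s z) / k - u z) = (\<lambda>z. rw k z + (-1) * rv k z)" for k
          by (simp add: h_def u_def rw_def rv_def fun_eq_iff diff_divide_distrib)
        then have "L2_norm (\<lambda>z. (h (s + k) z - h s z) / k - u z) \<le> L2_norm (rw k) + \<bar>-1\<bar> * L2_norm (rv k)" for k
          using L2_norm_triangle[OF r(1) L2_per_cmult[OF r(2)], of k "-1" k] by (simp only: L2_norm_cmult)
        then show "\<forall>\<^sub>F k in at 0. norm (L2_norm (\<lambda>z. (h (s + k) z - h s z) / k - u z))
            \<le> L2_norm (rw k) + \<bar>-1\<bar> * L2_norm (rv k)"
          by simp
      qed
    qed
    ultimately show ?thesis by blast
  qed
  then obtain D where D: "\<And>s. ((\<lambda>s. (L2_norm (h s))\<^sup>2) has_real_derivative D s) (at s)"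
    "\<And>s. \<bar>D s\<bar> \<le> pi / 3 * (L2_norm (h s))\<^sup>2"
    by metis
  have "AE z in lborel. w 0 z = v0 z" "AE z in lborel. v 0 z = v0 z"
    using w v by (auto simp: is_global_solution_def)
  then have "AE z in lborel. z \<in> {-pi..pi} \<longrightarrow> h 0 z = 0" by eventually_elim (simp add: h_def)
  then have "L2_norm (h 0) = L2_norm (\<lambda>_. 0)"
    using L2_perD(1)[OF h] by (intro L2_norm_cong_AE) auto
  then have h0: "(L2_norm (h 0))\<^sup>2 = 0" by (simp add: L2_norm_def)
  have "(L2_norm (h t))\<^sup>2 = 0"
    by (rule Gronwall_zero[where N = "\<lambda>s. (L2_norm (h s))\<^sup>2", OF D _ h0]) simp
  then have "AE z in lborel. z \<in> {-pi..pi} \<longrightarrow> h t z = 0"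
    by (intro L2_norm_zero_AE h) simp
  then have "AE z in lborel. h t z = 0"
    by (rule AE_of_AE_period[rotated]) (simp add: L2_perD(2)[OF h])
  then show ?thesis by eventually_elim (simp add: h_def)
qed

subsection \<open>Classical solutions\<close>

text \<open>\<open>zper\<close> sends \<open>pi\<close> to \<open>- pi\<close>, so a function and
  its periodic continuation may differ at \<open>pi\<close>; this single point is null.\<close>

lemma set_integral_cong_period:
  fixes f g :: "real \<Rightarrow> real"
  assumes "\<And>z. z \<in> {-pi..<pi} \<Longrightarrow> f z = g z" "b \<in> {-pi..pi}"
  shows "(LBINT z:{-pi..b}. f z) = (LBINT z:{-pi..b}. g z)"
proof -
  have remove: "(LBINT z:{-pi..b}. h z) = (LBINT z:{-pi..b} - {pi}. h z)" for h :: "real \<Rightarrow> real"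
    by (rule set_integral_discrete_difference[of "{pi}"]) auto
  show ?thesis unfolding remove
    by (rule set_lebesgue_integral_cong) (use assms in auto)
qed

lemma L2_norm_le_bound:
  assumes f: "f \<in> L2_per" and bound: "\<And>z. z \<in> {-pi..pi} \<Longrightarrow> \<bar>f z\<bar> \<le> B"
  shows "L2_norm f \<le> B * sqrt (2 * pi)"
proof -
  have "0 \<le> B" using bound[of 0] by simp
  have "(LBINT z:{-pi..pi}. (f z)\<^sup>2) \<le> (LBINT z:{-pi..pi}. B\<^sup>2)"
  proof (rule set_integral_mono)
    show "set_integrable lborel {-pi..pi} (\<lambda>z. (f z)\<^sup>2)" by (rule L2_perD(3)[OF f])
    show "set_integrable lborel {-pi..pi} (\<lambda>z. B\<^sup>2)" by (simp add: set_integrable_def)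
    show "(f z)\<^sup>2 \<le> B\<^sup>2" if "z \<in> {-pi..pi}" for z
      using power_mono[OF bound[OF that], of 2] by simp
  qed
  also have "\<dots> = B\<^sup>2 * (2 * pi)" by (simp add: set_lebesgue_integral_def)
  finally have "L2_norm f \<le> sqrt (B\<^sup>2 * (2 * pi))"
    unfolding L2_norm_def by (rule real_sqrt_le_mono)
  then show ?thesis using \<open>0 \<le> B\<close> by (simp add: real_sqrt_mult)
qed

text \<open>Uniform continuity on the compact set \<open>{t - 1..t + 1} \<times> {a..b}\<close>; the
  time window is the reason for capping the distance at 1.\<close>

lemma jointly_continuous_uniform:
  fixes f :: "real \<Rightarrow> real \<Rightarrow> real"
  assumes f: "continuous_on (UNIV \<times> {a..b}) (\<lambda>p. f (fst p) (snd p))" and "0 < e"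
  obtains d where "0 < d" "\<And>s z. \<bar>s - t\<bar> < d \<Longrightarrow> z \<in> {a..b} \<Longrightarrow> \<bar>f s z - f t z\<bar> < e"
proof -
  have "continuous_on ({t - 1..t + 1} \<times> {a..b}) (\<lambda>p. f (fst p) (snd p))"
    using f by (rule continuous_on_subset) auto
  then have "uniformly_continuous_on ({t - 1..t + 1} \<times> {a..b}) (\<lambda>p. f (fst p) (snd p))"
    by (rule compact_uniformly_continuous) (intro compact_Times compact_Icc)
  then obtain d where d: "0 < d" "\<And>p q. p \<in> {t - 1..t + 1} \<times> {a..b} \<Longrightarrow> q \<in> {t - 1..t + 1} \<times> {a..b}
      \<Longrightarrow> dist q p < d \<Longrightarrow> dist (f (fst q) (snd q)) (f (fst p) (snd p)) < e"
    unfolding uniformly_continuous_on_def using \<open>0 < e\<close> by metis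
  show thesis
  proof (rule that[of "min d 1"])
    fix s z assume "\<bar>s - t\<bar> < min d 1" and z: "z \<in> {a..b}"
    then have "(s, z) \<in> {t - 1..t + 1} \<times> {a..b}" "(t, z) \<in> {t - 1..t + 1} \<times> {a..b}"
      "dist (s, z) (t, z) < d"
      by (auto simp: dist_Pair_Pair dist_real_def)
    then show "\<bar>f s z - f t z\<bar> < e" using d(2)[of "(t, z)" "(s, z)"] by (simp add: dist_real_def)
  qed (use d in auto)
qed

lemma L2_norm_tendsto_zero:
  assumes f: "\<And>k. f k \<in> L2_per"
    and unif: "\<And>e. 0 < e \<Longrightarrow> \<exists>d>0. \<forall>k z. k \<noteq> a \<and> \<bar>k - a\<bar> < d \<and> z \<in> {-pi..pi} \<longrightarrow> \<bar>f k z\<bar> \<le> e"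
  shows "((\<lambda>k::real. L2_norm (f k)) \<longlongrightarrow> 0) (at a)"
proof (rule tendstoI)
  fix e :: real assume "0 < e"
  define e' where "e' = e / (2 * sqrt (2 * pi))"
  have "0 < e'" using \<open>0 < e\<close> by (simp add: e'_def)
  then obtain d where d: "0 < d" "\<forall>k z. k \<noteq> a \<and> \<bar>k - a\<bar> < d \<and> z \<in> {-pi..pi} \<longrightarrow> \<bar>f k z\<bar> \<le> e'"
    using unif by blast
  have "dist (L2_norm (f k)) 0 < e" if "k \<noteq> a" "dist k a < d" for k
  proof -
    have "L2_norm (f k) \<le> e' * sqrt (2 * pi)"
      using d that by (intro L2_norm_le_bound f) (auto simp: dist_real_def)
    also have "\<dots> = e / 2" by (simp add: e'_def)
    finally show ?thesis using \<open>0 < e\<close> by (simp add: dist_real_def)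
  qed
  then show "\<forall>\<^sub>F k in at a. dist (L2_norm (f k)) 0 < e"
    unfolding eventually_at using d(1) by blast
qed

text \<open>The boundary terms cancel because \<open>S\<close> agrees at the two ends. The values of
  \<open>g\<close> there may differ, as \<open>g\<close> enters only through integrals.\<close>

lemma has_weak_deriv_per_zper:
  assumes S: "\<And>z. z \<in> {-pi..pi} \<Longrightarrow> (S has_real_derivative g z) (at z within {-pi..pi})"
    and g: "continuous_on {-pi..pi} g" and per: "S pi = S (-pi)"
  shows "has_weak_deriv_per (\<lambda>z. S (zper z)) (\<lambda>z. g (zper z))"
  unfolding has_weak_deriv_per_def
proof (intro allI impI)
  fix \<phi> assume \<phi>: "smooth_per \<phi>"
  have cS: "continuous_on {-pi..pi} S"
    using S by (intro DERIV_continuous_on)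
  have "(LBINT z:{-pi..pi}. g z * \<phi> z + S z * deriv \<phi> z) = S pi * \<phi> pi - S (-pi) * \<phi> (-pi)"
    using deriv_smooth_per_AC[OF \<phi>]
    by (intro product_rule_absolutely_continuous(2) integral_of_C1[OF S g] borel_integrable_atLeastAtMost' g
        smooth_per_continuous smooth_per_deriv \<phi>) auto
  moreover have "\<phi> pi = \<phi> (-pi)"
    using L2_perD(2)[OF smooth_per_L2[OF \<phi>], of "-pi"] by simp
  moreover have "(LBINT z:{-pi..pi}. g z * \<phi> z + S z * deriv \<phi> z)
      = (LBINT z:{-pi..pi}. g z * \<phi> z) + (LBINT z:{-pi..pi}. S z * deriv \<phi> z)"
    by (intro set_integral_add borel_integrable_atLeastAtMost' continuous_on_mult g cS
        smooth_per_continuous smooth_per_deriv \<phi>)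
  ultimately have "(LBINT z:{-pi..pi}. S z * deriv \<phi> z) = - (LBINT z:{-pi..pi}. g z * \<phi> z)"
    using per by simp
  moreover have "(LBINT z:{-pi..pi}. S (zper z) * deriv \<phi> z) = (LBINT z:{-pi..pi}. S z * deriv \<phi> z)"
    "(LBINT z:{-pi..pi}. g (zper z) * \<phi> z) = (LBINT z:{-pi..pi}. g z * \<phi> z)"
    by (intro set_integral_cong_period; simp add: zper_eq)+
  ultimately show "(LBINT z:{-pi..pi}. S (zper z) * deriv \<phi> z) = - (LBINT z:{-pi..pi}. g (zper z) * \<phi> z)"
    by simp
qed

lemma continuous_on_time_slice:
  fixes f :: "real \<Rightarrow> real \<Rightarrow> real"
  assumes "continuous_on (UNIV \<times> A) (\<lambda>p. f (fst p) (snd p))"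
  shows "continuous_on A (f t)"
proof -
  have "continuous_on A (\<lambda>z. (t, z))"
    by (intro continuous_on_Pair continuous_on_const continuous_on_id)
  from continuous_on_compose2[OF assms this] show ?thesis by auto
qed

text \<open>Reduces the notion of solution to pointwise calculus on one closed period. Joint
  continuity gives convergence in time that is uniform in \<open>z\<close>, hence the limits in the
  norms of \<open>X1_per\<close> and \<open>L2_per\<close>. The function \<open>v\<close> may jump
  across the ends of the period because \<open>speed * v\<close> vanishes there.\<close>

lemma classical_solution_is_global_solution:
  fixes w v v' g :: "real \<Rightarrow> real \<Rightarrow> real"
  assumes w: "\<And>t z. z \<in> {-pi..pi} \<Longrightarrow> (w t has_real_derivative v t z) (at z within {-pi..pi})"
    and w_per: "\<And>t. w t pi = w t (-pi)" and w_mean: "\<And>t. (LBINT z:{-pi..pi}. w t z) = 0"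
    and S: "\<And>t z. z \<in> {-pi..pi} \<Longrightarrow>
      ((\<lambda>z. speed z * v t z) has_real_derivative g t z) (at z within {-pi..pi})"
    and v': "\<And>t z. z \<in> {-pi..pi} \<Longrightarrow> ((\<lambda>t. v t z) has_real_derivative v' t z) (at t)"
    and v_cont: "continuous_on (UNIV \<times> {-pi..pi}) (\<lambda>p. v (fst p) (snd p))"
    and v'_cont: "continuous_on (UNIV \<times> {-pi..pi}) (\<lambda>p. v' (fst p) (snd p))"
    and g_cont: "continuous_on (UNIV \<times> {-pi..pi}) (\<lambda>p. g (fst p) (snd p))"
    and pde: "\<And>t z. z \<in> {-pi..pi} \<Longrightarrow> v' t z + g t z = w t z"
  shows "is_global_solution (\<lambda>z. v 0 (zper z)) (\<lambda>t z. v t (zper z))"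
proof -
  note v_slice = continuous_on_time_slice[OF v_cont] and v'_slice = continuous_on_time_slice[OF v'_cont] and g_slice = continuous_on_time_slice[OF g_cont]
  have zI: "zper z \<in> {-pi..pi}" for z using zper_bounds[of z] by auto
  note L2 = L2_per_zper[OF v_slice] L2_per_zper[OF v'_slice] L2_per_zper[OF g_slice]
  have mean: "(LBINT z:{-pi..pi}. v t (zper z)) = 0" for t
  proof -
    have "w t pi = w t (-pi) + (LBINT z:{-pi..pi}. v t z)"
      by (rule integral_of_C1[OF w v_slice]) auto
    then show ?thesis using w_per[of t]
      by (subst set_integral_cong_period[of _ "v t"]) (auto simp: zper_eq)
  qed
  \<comment> \<open>By the equation \<open>v'\<close> is \<open>w - g\<close>, where
    \<open>w\<close> has zero mean and \<open>g\<close> is the derivative of a function that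
    vanishes at both ends.\<close>
  have mean': "(LBINT z:{-pi..pi}. v' t (zper z)) = 0" for t
  proof -
    have cw: "continuous_on {-pi..pi} (w t)" using w by (intro DERIV_continuous_on)
    have "speed pi * v t pi = speed (-pi) * v t (-pi) + (LBINT z:{-pi..pi}. g t z)"
      by (rule integral_of_C1[OF S g_slice]) auto
    then have "0 = (LBINT z:{-pi..pi}. w t z) - (LBINT z:{-pi..pi}. g t z)" by (simp add: w_mean)
    also have "\<dots> = (LBINT z:{-pi..pi}. w t z - g t z)"
      by (intro set_integral_diff(2)[symmetric] borel_integrable_atLeastAtMost' cw g_slice)
    also have "\<dots> = (LBINT z:{-pi..pi}. v' t (zper z))"
      by (rule set_integral_cong_period) (auto simp: zper_eq pde[symmetric])
    finally show ?thesis by simp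
  qed
  have dot: "(\<lambda>z. v t (zper z)) \<in> L2_dot_per" "(\<lambda>z. v' t (zper z)) \<in> L2_dot_per" for t
    using L2 mean mean' by (auto simp: L2_dot_per_def)
  have weak: "has_weak_deriv_per (\<lambda>z. speed (zper z) * v t (zper z)) (\<lambda>z. g t (zper z))" for t
    by (rule has_weak_deriv_per_zper[OF S g_slice]) auto
  have cont_speed: "continuous_on A speed" for A
    unfolding speed_def[abs_def] by (intro continuous_intros) auto
  have SL2: "(\<lambda>z. speed (zper z) * v t (zper z)) \<in> L2_per" for t
    by (intro L2_per_zper[of "\<lambda>z. speed z * v t z"] continuous_on_mult cont_speed v_slice)
  have neg: "(\<lambda>z. 1/6 * (pi\<^sup>2 - (zper z)\<^sup>2) * f z) = (\<lambda>z. (-1) * (speed (zper z) * f z))" for f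
    by (simp add: speed_def fun_eq_iff field_simps)
  have X1: "(\<lambda>z. v t (zper z)) \<in> X1_per" for t
    unfolding X1_per_def H1_per_def neg
    using dot L2_per_cmult[OF SL2, of "-1" t] L2_per_cmult[OF L2(3), of "-1" t]
      has_weak_deriv_per_cmult[OF weak, of "-1" t] by blast
  have "continuous_X1 (\<lambda>t z. v t (zper z))"
    unfolding continuous_X1_def
  proof (intro conjI allI X1)
    fix t
    \<comment> \<open>The norm is computed from an explicit weak derivative, which agrees almost
      everywhere with whatever \<open>dz\<close> picks; the opposite signs of \<open>speed\<close>
      and the weight do not affect it.\<close>
    have dz_eq: "L2_norm (dz (\<lambda>z. 1/6 * (pi\<^sup>2 - (zper z)\<^sup>2) * (v s (zper z) - v t (zper z))))
        = L2_norm (\<lambda>z. g s (zper z) - g t (zper z))" for s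
    proof -
      define f where "f = (\<lambda>z. (-1) * (speed (zper z) * v s (zper z) - speed (zper z) * v t (zper z)))"
      define G where "G = (\<lambda>z. (-1) * (g s (zper z) - g t (zper z)))"
      have f: "(\<lambda>z. 1/6 * (pi\<^sup>2 - (zper z)\<^sup>2) * (v s (zper z) - v t (zper z))) = f"
        unfolding neg f_def by (simp add: right_diff_distrib)
      have "f \<in> L2_per" "G \<in> L2_per" unfolding f_def G_def by (intro L2_per_cmult L2_per_diff SL2 L2)+
      moreover have "has_weak_deriv_per f G"
        unfolding f_def G_def by (intro has_weak_deriv_per_cmult has_weak_deriv_per_diff SL2 L2 weak)
      ultimately have AE: "AE z in lborel. dz f z = G z" and "dz f \<in> L2_per"
        by (auto intro!: dz_eq_AE dz_of_H1 simp: H1_per_def)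
      then have "L2_norm (dz f) = L2_norm G"
        using AE L2_perD(1)[OF \<open>G \<in> L2_per\<close>] L2_perD(1)[OF \<open>dz f \<in> L2_per\<close>]
        by (intro L2_norm_cong_AE) auto
      also have "\<dots> = L2_norm (\<lambda>z. g s (zper z) - g t (zper z))" unfolding G_def L2_norm_cmult by simp
      finally show ?thesis unfolding f .
    qed
    have lim: "((\<lambda>s. L2_norm (\<lambda>z. f s (zper z) - f t (zper z))) \<longlongrightarrow> 0) (at t)"
      if f: "continuous_on (UNIV \<times> {-pi..pi}) (\<lambda>p. f (fst p) (snd p))" for f
    proof (rule L2_norm_tendsto_zero)
      show "(\<lambda>z. f s (zper z) - f t (zper z)) \<in> L2_per" for s
        by (intro L2_per_diff L2_per_zper continuous_on_time_slice[OF f])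
      fix e :: real assume "0 < e"
      then obtain d where d: "0 < d" "\<And>s z. \<bar>s - t\<bar> < d \<Longrightarrow> z \<in> {-pi..pi} \<Longrightarrow> \<bar>f s z - f t z\<bar> < e"
        using jointly_continuous_uniform[OF f] by blast
      show "\<exists>d>0. \<forall>k z. k \<noteq> t \<and> \<bar>k - t\<bar> < d \<and> z \<in> {-pi..pi} \<longrightarrow> \<bar>f k (zper z) - f t (zper z)\<bar> \<le> e"
        using d zI by (meson less_imp_le)
    qed
    show "((\<lambda>s. X1_norm (\<lambda>z. v s (zper z) - v t (zper z))) \<longlongrightarrow> 0) (at t)"
      unfolding X1_norm_def dz_eq using tendsto_add[OF lim[OF v_cont] lim[OF g_cont]] by simp
  qed
  moreover have "has_L2_time_deriv (\<lambda>t z. v t (zper z)) (\<lambda>z. v' t (zper z)) t" for t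
    unfolding has_L2_time_deriv_def
  proof (intro conjI dot L2_norm_tendsto_zero)
    fix k
    have "(\<lambda>z. inverse k * (v (t + k) (zper z) - v t (zper z)) - v' t (zper z)) \<in> L2_per"
      by (intro L2_per_diff L2_per_cmult L2)
    then show "(\<lambda>z. (v (t + k) (zper z) - v t (zper z)) / k - v' t (zper z)) \<in> L2_per"
      by (simp add: divide_inverse mult.commute)
  next
    fix e :: real assume "0 < e"
    then obtain d where d: "0 < d" "\<And>s z. \<bar>s - t\<bar> < d \<Longrightarrow> z \<in> {-pi..pi} \<Longrightarrow> \<bar>v' s z - v' t z\<bar> < e"
      using jointly_continuous_uniform[OF v'_cont] by blast
    have "\<bar>(v (t + k) z - v t z) / k - v' t z\<bar> \<le> e" if k: "k \<noteq> 0" "\<bar>k\<bar> < d" and z: "z \<in> {-pi..pi}" for k z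
    proof -
      \<comment> \<open>By the mean value theorem the difference quotient is \<open>v'\<close> at an
        intermediate time, which is close to \<open>v'\<close> at \<open>t\<close> uniformly in
        \<open>z\<close>.\<close>
      obtain s where s: "\<bar>s - t\<bar> < d" "v (t + k) z - v t z = k * v' s z"
      proof (cases "0 < k")
        case True
        then obtain s where "t < s" "s < t + k" "v (t + k) z - v t z = (t + k - t) * v' s z"
          using MVT2[of t "t + k" "\<lambda>t. v t z" "\<lambda>t. v' t z"] v'[OF z] by auto
        then show thesis using k by (intro that[of s]) auto
      next
        case False
        then obtain s where "t + k < s" "s < t" "v t z - v (t + k) z = (t - (t + k)) * v' s z"
          using k MVT2[of "t + k" t "\<lambda>t. v t z" "\<lambda>t. v' t z"] v'[OF z] by auto
        then show thesis using k by (intro that[of s]) auto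
      qed
      then show ?thesis using d(2)[OF s(1) z] k by simp
    qed
    then show "\<exists>d>0. \<forall>k z. k \<noteq> 0 \<and> \<bar>k - 0\<bar> < d \<and> z \<in> {-pi..pi} \<longrightarrow>
        \<bar>(v (t + k) (zper z) - v t (zper z)) / k - v' t (zper z)\<bar> \<le> e"
      using d(1) zI by (metis diff_zero)
  qed
  moreover have "AE z in lborel. v' t (zper z) + dz (\<lambda>y. 1/6 * ((zper y)\<^sup>2 - pi\<^sup>2) * v t (zper y)) z
      = dz_inv (\<lambda>z. v t (zper z)) z" for t
  proof -
    have "(\<lambda>y. 1/6 * ((zper y)\<^sup>2 - pi\<^sup>2) * v t (zper y)) = (\<lambda>y. speed (zper y) * v t (zper y))"
      by (simp add: speed_def fun_eq_iff)
    then have "AE z in lborel. dz (\<lambda>y. 1/6 * ((zper y)\<^sup>2 - pi\<^sup>2) * v t (zper y)) z = g t (zper z)"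
      using dz_eq_AE[OF SL2 L2(3) weak] by simp
    moreover have "dz_inv (\<lambda>z. v t (zper z)) z = w t (zper z)" for z
    proof -
      have "dz_inv (\<lambda>z. v t (zper z)) (zper z) = w t (zper z)"
      proof (rule dz_inv_eqI[OF dot(1) _ w_mean zI])
        fix z assume z: "z \<in> {-pi..pi}"
        have "w t z = w t (-pi) + (LBINT y:{-pi..z}. v t y)"
          by (rule integral_of_C1[OF w v_slice z])
        also have "(LBINT y:{-pi..z}. v t y) = (LBINT y:{-pi..z}. v t (zper y))"
          by (rule set_integral_cong_period[OF _ z]) (simp add: zper_eq)
        finally show "w t z = w t (-pi) + (LBINT y:{-pi..z}. v t (zper y))" .
      qed
      then show ?thesis using periodic_zper[of "dz_inv (\<lambda>z. v t (zper z))" z, OF dz_inv_props(1)[OF dot(1)]]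
        by simp
    qed
    ultimately show ?thesis
      by (auto elim!: eventually_mono simp: pde[OF zI])
  qed
  ultimately show ?thesis unfolding is_global_solution_def by auto
qed

subsection \<open>An explicit solution\<close>

text \<open>The equation for the antiderivative \<open>w\<close> is the Euler--Poisson--Darboux equation
  \<open>w\<^sub>A\<^sub>T = 6 w / (A + T)\<^sup>2\<close> in \<open>A = T (\<pi> + z) / (\<pi> - z)\<close> and \<open>T = 15 exp (\<pi> t / 3)\<close>; it has the
  solutions \<open>F'' - 6 F' / (A + T) + 12 F / (A + T)\<^sup>2\<close>. The choice \<open>F = A\<^sup>3 / (1 + A)\<^sup>2\<close> makes \<open>w\<close> a
  polynomial in \<open>y = 1 / (1 + A)\<close> and \<open>r = 1 + z / \<pi>\<close> that vanishes at both end points.\<close>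

definition T_sol :: "real \<Rightarrow> real" where
  "T_sol t = 15 * exp (pi * t / 3)"

definition D_sol :: "real \<Rightarrow> real \<Rightarrow> real" where
  "D_sol t z = (pi - z) + T_sol t * (pi + z)"

definition y_sol :: "real \<Rightarrow> real \<Rightarrow> real" where
  "y_sol t z = (pi - z) / D_sol t z"

text \<open>Minus the \<open>z\<close>-derivative of \<open>y_sol\<close>; with this sign it is
  positive on the period.\<close>

definition Y_sol :: "real \<Rightarrow> real \<Rightarrow> real" where
  "Y_sol t z = 2 * pi * T_sol t / (D_sol t z)\<^sup>2"

text \<open>The result of substituting \<open>A = (1 - y) / y\<close> and
  \<open>1 / (A + T) = r * y / (2 * (1 - y))\<close>: the three terms of the general solution become
  \<open>6 * y^3 * (1 - y)\<close>, \<open>- 3 * r * y * (1 - y) * (1 + 2 * y)\<close> and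
  \<open>3 * r^2 * y * (1 - y)\<close>. Their common factor \<open>y * (1 - y)\<close> vanishes at
  both ends of the period.\<close>

definition W_poly :: "real \<Rightarrow> real \<Rightarrow> real" where
  "W_poly y r = 3 * (y * (1 - y)) * (2 * y\<^sup>2 - 2 * y * r - r + r\<^sup>2)"

definition Wr_poly :: "real \<Rightarrow> real \<Rightarrow> real" where
  "Wr_poly y r = 3 * (y * (1 - y)) * (2 * r - 2 * y - 1)"

definition Wy_poly :: "real \<Rightarrow> real \<Rightarrow> real" where
  "Wy_poly y r = 3 * ((1 - 2 * y) * (2 * y\<^sup>2 - 2 * y * r - r + r\<^sup>2) + y * (1 - y) * (4 * y - 2 * r))"

definition Wyr_poly :: "real \<Rightarrow> real \<Rightarrow> real" where
  "Wyr_poly y r = 3 * ((1 - 2 * y) * (2 * r - 2 * y - 1) - 2 * (y * (1 - y)))"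

definition Wyy_poly :: "real \<Rightarrow> real \<Rightarrow> real" where
  "Wyy_poly y r = 3 * (- 2 * (2 * y\<^sup>2 - 2 * y * r - r + r\<^sup>2)
     + 2 * (1 - 2 * y) * (4 * y - 2 * r) + 4 * (y * (1 - y)))"

definition w_sol :: "real \<Rightarrow> real \<Rightarrow> real" where
  "w_sol t z = W_poly (y_sol t z) (1 + z / pi)"

definition v_sol :: "real \<Rightarrow> real \<Rightarrow> real" where
  "v_sol t z = Wr_poly (y_sol t z) (1 + z / pi) / pi - Y_sol t z * Wy_poly (y_sol t z) (1 + z / pi)"

text \<open>\<open>3 / pi\<close> times the time derivative of \<open>w_sol\<close>.\<close>

definition M_sol :: "real \<Rightarrow> real \<Rightarrow> real" where
  "M_sol t z = - (y_sol t z * (1 - y_sol t z)) * Wy_poly (y_sol t z) (1 + z / pi)"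

text \<open>Up to the factor \<open>- pi / 6\<close>, the derivative of \<open>w_sol\<close> along
  characteristics, where \<open>y\<close> is constant and only \<open>r\<close> varies. The equation
  requires this derivative to be an antiderivative of \<open>w_sol\<close>.\<close>

definition B_sol :: "real \<Rightarrow> real \<Rightarrow> real" where
  "B_sol t z = (1 + z / pi) * (1 - z / pi) * Wr_poly (y_sol t z) (1 + z / pi)"

definition v'_sol :: "real \<Rightarrow> real \<Rightarrow> real" where
  "v'_sol t z = pi / 3 * (- (y_sol t z * (1 - y_sol t z)) * Wyr_poly (y_sol t z) (1 + z / pi) / pi
     + Y_sol t z * ((1 - 2 * y_sol t z) * Wy_poly (y_sol t z) (1 + z / pi)
       + y_sol t z * (1 - y_sol t z) * Wyy_poly (y_sol t z) (1 + z / pi)))"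

section \<open>Calculus of the building blocks of the explicit solution\<close>

lemma T_sol_pos: "0 < T_sol t"
  by (simp add: T_sol_def)

lemma D_sol_pos:
  assumes "z \<in> {-pi..pi}"
  shows "0 < D_sol t z"
proof (cases "z = pi")
  case True
  then show ?thesis using T_sol_pos by (simp add: D_sol_def)
next
  case False
  then show ?thesis using assms T_sol_pos[of t]
    unfolding D_sol_def by (intro add_pos_nonneg mult_nonneg_nonneg) auto
qed

lemma one_minus_y_sol:
  assumes "z \<in> {-pi..pi}"
  shows "1 - y_sol t z = T_sol t * (pi + z) / D_sol t z"
  using D_sol_pos[OF assms, of t] by (simp add: y_sol_def diff_divide_eq_iff) (simp add: D_sol_def)

text \<open>This expresses that \<open>y_sol\<close> is constant along characteristics: after
  multiplication by \<open>pi / 6\<close>, the left side is \<open>speed\<close> times the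
  \<open>z\<close>-derivative of \<open>y_sol\<close> and the right side is minus its time
  derivative.\<close>

lemma y_Y_sol_relation:
  assumes "z \<in> {-pi..pi}"
  shows "pi * ((1 + z / pi) * (1 - z / pi)) * Y_sol t z = 2 * (y_sol t z * (1 - y_sol t z))"
proof -
  have D: "D_sol t z \<noteq> 0" using D_sol_pos[OF assms, of t] by simp
  have "pi * ((1 + z / pi) * (1 - z / pi)) = (pi + z) * (pi - z) / pi"
    by (simp add: field_simps)
  then show ?thesis unfolding one_minus_y_sol[OF assms] using D
    by (simp add: y_sol_def Y_sol_def power2_eq_square field_simps)
qed

lemma y_sol_deriv_z:
  assumes "z \<in> {-pi..pi}"
  shows "((\<lambda>z. y_sol t z) has_real_derivative - Y_sol t z) (at z)"
proof -
  have D: "D_sol t z \<noteq> 0" using D_sol_pos[OF assms, of t] by simp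
  have "((\<lambda>z. D_sol t z) has_real_derivative T_sol t - 1) (at z)"
    unfolding D_sol_def by (auto intro!: derivative_eq_intros)
  then have "((\<lambda>z. y_sol t z) has_real_derivative
      ((-1) * D_sol t z - (pi - z) * (T_sol t - 1)) / (D_sol t z * D_sol t z)) (at z)"
    unfolding y_sol_def using D by (auto intro!: derivative_eq_intros)
  moreover have "(-1) * D_sol t z - (pi - z) * (T_sol t - 1) = - (2 * pi * T_sol t)"
    by (simp add: D_sol_def algebra_simps)
  ultimately show ?thesis by (simp add: Y_sol_def power2_eq_square)
qed

lemma T_sol_deriv: "(T_sol has_real_derivative pi / 3 * T_sol t) (at t)"
  unfolding T_sol_def[abs_def] by (auto intro!: derivative_eq_intros)

lemma D_sol_deriv_t: "((\<lambda>t. D_sol t z) has_real_derivative pi / 3 * T_sol t * (pi + z)) (at t)"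
  unfolding D_sol_def by (auto intro!: derivative_eq_intros T_sol_deriv)

lemma y_sol_deriv_t:
  assumes "z \<in> {-pi..pi}"
  shows "((\<lambda>t. y_sol t z) has_real_derivative - (pi / 3) * (y_sol t z * (1 - y_sol t z))) (at t)"
proof -
  have D: "D_sol t z \<noteq> 0" using D_sol_pos[OF assms, of t] by simp
  have "((\<lambda>t. y_sol t z) has_real_derivative
      - ((pi - z) * (pi / 3 * T_sol t * (pi + z))) / (D_sol t z * D_sol t z)) (at t)"
    unfolding y_sol_def using D by (auto intro!: derivative_eq_intros D_sol_deriv_t)
  moreover have "- ((pi - z) * (pi / 3 * T_sol t * (pi + z))) / (D_sol t z * D_sol t z)
      = - (pi / 3) * (y_sol t z * (1 - y_sol t z))"
    unfolding one_minus_y_sol[OF assms] using D by (simp add: y_sol_def)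
  ultimately show ?thesis by (simp only:)
qed

lemma Y_sol_deriv_t:
  assumes "z \<in> {-pi..pi}"
  shows "((\<lambda>t. Y_sol t z) has_real_derivative pi / 3 * Y_sol t z * (2 * y_sol t z - 1)) (at t)"
proof -
  have D: "D_sol t z \<noteq> 0" using D_sol_pos[OF assms, of t] by simp
  have "((\<lambda>t. Y_sol t z) has_real_derivative
      (2 * pi * (pi / 3 * T_sol t) * (D_sol t z)\<^sup>2
        - 2 * pi * T_sol t * (2 * D_sol t z * (pi / 3 * T_sol t * (pi + z))))
      / ((D_sol t z)\<^sup>2 * (D_sol t z)\<^sup>2)) (at t)"
    unfolding Y_sol_def using D
    by (auto intro!: derivative_eq_intros D_sol_deriv_t T_sol_deriv) (simp add: mult_ac)
  moreover have "(2 * pi * (pi / 3 * T_sol t) * (D_sol t z)\<^sup>2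
        - 2 * pi * T_sol t * (2 * D_sol t z * (pi / 3 * T_sol t * (pi + z))))
      / ((D_sol t z)\<^sup>2 * (D_sol t z)\<^sup>2) = pi / 3 * Y_sol t z * (1 - 2 * (1 - y_sol t z))"
    unfolding one_minus_y_sol[OF assms] using D by (simp add: Y_sol_def power2_eq_square field_simps)
  moreover have "1 - 2 * (1 - y_sol t z) = 2 * y_sol t z - 1" by simp
  ultimately show ?thesis by (simp only:)
qed

context
  fixes y r :: "real \<Rightarrow> real" and y' r' x :: real
  assumes y: "(y has_real_derivative y') (at x)" and r: "(r has_real_derivative r') (at x)"
begin

lemma W_poly_deriv:
  "((\<lambda>x. W_poly (y x) (r x)) has_real_derivative
    y' * Wy_poly (y x) (r x) + r' * Wr_poly (y x) (r x)) (at x)"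
  unfolding W_poly_def Wy_poly_def Wr_poly_def
  by (auto intro!: derivative_eq_intros y r) (simp add: power2_eq_square algebra_simps)

lemma Wr_poly_deriv:
  "((\<lambda>x. Wr_poly (y x) (r x)) has_real_derivative
    y' * Wyr_poly (y x) (r x) + r' * (6 * (y x * (1 - y x)))) (at x)"
  unfolding Wr_poly_def Wyr_poly_def
  by (auto intro!: derivative_eq_intros y r) (simp add: power2_eq_square algebra_simps)

lemma Wy_poly_deriv:
  "((\<lambda>x. Wy_poly (y x) (r x)) has_real_derivative
    y' * Wyy_poly (y x) (r x) + r' * Wyr_poly (y x) (r x)) (at x)"
  unfolding Wy_poly_def Wyy_poly_def Wyr_poly_def
  by (auto intro!: derivative_eq_intros y r) (simp add: power2_eq_square algebra_simps)

end

lemma r_deriv: "((\<lambda>z. 1 + z / pi) has_real_derivative 1 / pi) (at z)"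
  by (auto intro!: derivative_eq_intros)

lemma one_minus_r_deriv: "((\<lambda>z. 1 - z / pi) has_real_derivative - (1 / pi)) (at z)"
  by (auto intro!: derivative_eq_intros)

lemma w_sol_deriv:
  assumes "z \<in> {-pi..pi}"
  shows "(w_sol t has_real_derivative v_sol t z) (at z)"
  using W_poly_deriv[OF y_sol_deriv_z[OF assms] r_deriv, of t]
  by (simp add: w_sol_def[abs_def] v_sol_def)

text \<open>Equality of the mixed derivatives of \<open>w_sol\<close>, as \<open>M_sol\<close> is a
  multiple of its time derivative and \<open>v'_sol\<close> is the time derivative of
  \<open>v_sol\<close>.\<close>

lemma M_sol_deriv:
  assumes "z \<in> {-pi..pi}"
  shows "(M_sol t has_real_derivative 3 / pi * v'_sol t z) (at z)"
  unfolding M_sol_def[abs_def]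
  by (rule derivative_eq_intros Wy_poly_deriv[OF y_sol_deriv_z[OF assms] r_deriv]
      y_sol_deriv_z[OF assms] refl)+ (simp add: v'_sol_def algebra_simps)

lemma B_sol_deriv:
  assumes z: "z \<in> {-pi..pi}"
  shows "(B_sol t has_real_derivative - 6 / pi * w_sol t z) (at z)"
proof -
  define y r Y where "y = y_sol t z" and "r = 1 + z / pi" and "Y = Y_sol t z"
  have r2: "1 - z / pi = 2 - r" by (simp add: r_def)
  have rel: "r * (2 - r) * Y = 2 * (y * (1 - y)) / pi"
    using y_Y_sol_relation[OF z, of t] unfolding r2
    by (simp add: y_def[symmetric] r_def[symmetric] Y_def[symmetric] field_simps)
  have "(B_sol t has_real_derivative (1 / pi * (1 - z / pi) + - (1 / pi) * (1 + z / pi)) * Wr_poly y r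
      + (- Y * Wyr_poly y r + 1 / pi * (6 * (y * (1 - y)))) * ((1 + z / pi) * (1 - z / pi))) (at z)"
    unfolding B_sol_def[abs_def] y_def r_def Y_def
    by (rule DERIV_cong[OF DERIV_mult'[OF DERIV_mult'[OF r_deriv one_minus_r_deriv]
          Wr_poly_deriv[OF y_sol_deriv_z[OF z] r_deriv]]]) (simp add: field_simps)
  also have "(1 / pi * (1 - z / pi) + - (1 / pi) * (1 + z / pi)) * Wr_poly y r
      + (- Y * Wyr_poly y r + 1 / pi * (6 * (y * (1 - y)))) * ((1 + z / pi) * (1 - z / pi))
      = ((2 - 2 * r) * Wr_poly y r + r * (2 - r) * (6 * (y * (1 - y)))) / pi
      - (r * (2 - r) * Y) * Wyr_poly y r"
    unfolding r2 r_def[symmetric] by (simp add: field_simps)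
  also have "\<dots> = ((2 - 2 * r) * Wr_poly y r + r * (2 - r) * (6 * (y * (1 - y))) - 2 * (y * (1 - y)) * Wyr_poly y r) / pi"
    unfolding rel by (simp add: diff_divide_distrib)
  \<comment> \<open>Once \<open>rel\<close> has removed \<open>Y\<close>, the
    Euler--Poisson--Darboux equation is this polynomial identity in \<open>y\<close> and
    \<open>r\<close>.\<close>
  also have "(2 - 2 * r) * Wr_poly y r + r * (2 - r) * (6 * (y * (1 - y))) - 2 * (y * (1 - y)) * Wyr_poly y r
      = - 6 * W_poly y r"
    unfolding Wr_poly_def Wyr_poly_def W_poly_def by algebra
  finally show ?thesis by (simp add: w_sol_def y_def r_def)
qed

lemma v_sol_deriv_t:
  assumes "z \<in> {-pi..pi}"
  shows "((\<lambda>t. v_sol t z) has_real_derivative v'_sol t z) (at t)"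
  unfolding v_sol_def
  by (rule DERIV_cong[OF DERIV_diff[OF
        DERIV_cdivide[OF Wr_poly_deriv[OF y_sol_deriv_t[OF assms] DERIV_const]]
        DERIV_mult'[OF Y_sol_deriv_t[OF assms] Wy_poly_deriv[OF y_sol_deriv_t[OF assms] DERIV_const]]]])
    (simp add: v'_sol_def field_simps)

text \<open>The equation integrated once in \<open>z\<close>: the time derivative of
  \<open>w_sol\<close> is \<open>pi / 3 * M_sol\<close>, and \<open>- pi / 6 * B_sol\<close> is an
  antiderivative of \<open>w_sol\<close>. The relation between \<open>y_sol\<close> and
  \<open>Y_sol\<close> makes the two sides agree.\<close>

lemma speed_v_sol:
  assumes z: "z \<in> {-pi..pi}"
  shows "speed z * v_sol t z = - (pi / 3) * M_sol t z - pi / 6 * B_sol t z"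
proof -
  define R where "R = (1 + z / pi) * (1 - z / pi)"
  have speed: "speed z = - (pi\<^sup>2 / 6) * R"
    by (simp add: speed_def R_def power2_eq_square field_simps)
  have rel: "pi * R * Y_sol t z = 2 * (y_sol t z * (1 - y_sol t z))"
    using y_Y_sol_relation[OF z, of t] by (simp only: R_def)
  have "speed z * v_sol t z = - (pi / 6) * (R * Wr_poly (y_sol t z) (1 + z / pi))
      + pi / 6 * (pi * R * Y_sol t z) * Wy_poly (y_sol t z) (1 + z / pi)"
    unfolding speed v_sol_def by (simp add: power2_eq_square right_diff_distrib)
  from this[unfolded rel] show ?thesis
    by (simp add: M_sol_def B_sol_def R_def mult.assoc)
qed

lemma speed_v_sol_deriv:
  assumes z: "z \<in> {-pi..pi}"
  shows "((\<lambda>z. speed z * v_sol t z) has_real_derivative w_sol t z - v'_sol t z) (at z within {-pi..pi})"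
\<comment> \<open>The identity \<open>speed_v_sol\<close> is available on the closed period only, so
  the derivative is transferred within it.\<close>
proof (rule has_field_derivative_transform_within[where d=1])
  have "((\<lambda>z. - (pi / 3) * M_sol t z - pi / 6 * B_sol t z) has_real_derivative
      - (pi / 3) * (3 / pi * v'_sol t z) - pi / 6 * (- 6 / pi * w_sol t z)) (at z)"
    by (rule DERIV_diff[OF DERIV_cmult[OF M_sol_deriv[OF z]] DERIV_cmult[OF B_sol_deriv[OF z]]])
  then show "((\<lambda>z. - (pi / 3) * M_sol t z - pi / 6 * B_sol t z) has_real_derivative w_sol t z - v'_sol t z)
      (at z within {-pi..pi})"
    by (rule has_field_derivative_at_within[OF DERIV_cong]) simp
qed (use z speed_v_sol in auto)

section \<open>Continuity, boundary values and mean of the explicit solution\<close>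

lemma T_sol_continuous: "continuous_on A (\<lambda>p. T_sol (fst p))"
  unfolding T_sol_def by (intro continuous_intros) auto

lemma y_Y_sol_continuous:
  "continuous_on (UNIV \<times> {-pi..pi}) (\<lambda>p. y_sol (fst p) (snd p))"
  "continuous_on (UNIV \<times> {-pi..pi}) (\<lambda>p. Y_sol (fst p) (snd p))"
proof -
  have ne: "\<forall>p\<in>UNIV \<times> {-pi..pi}. D_sol (fst p) (snd p) \<noteq> 0"
  proof
    fix p :: "real \<times> real" assume "p \<in> UNIV \<times> {-pi..pi}"
    then have "snd p \<in> {-pi..pi}" by (cases p) simp
    from D_sol_pos[OF this, of "fst p"] show "D_sol (fst p) (snd p) \<noteq> 0" by simp
  qed
  have D: "continuous_on (UNIV \<times> {-pi..pi}) (\<lambda>p. D_sol (fst p) (snd p))"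
    unfolding D_sol_def by (intro continuous_intros T_sol_continuous)
  show "continuous_on (UNIV \<times> {-pi..pi}) (\<lambda>p. y_sol (fst p) (snd p))"
    unfolding y_sol_def using ne by (intro continuous_intros D)
  show "continuous_on (UNIV \<times> {-pi..pi}) (\<lambda>p. Y_sol (fst p) (snd p))"
    unfolding Y_sol_def using ne by (intro continuous_intros D T_sol_continuous) auto
qed

lemma w_v_sol_continuous:
  "continuous_on (UNIV \<times> {-pi..pi}) (\<lambda>p. w_sol (fst p) (snd p))"
  "continuous_on (UNIV \<times> {-pi..pi}) (\<lambda>p. v_sol (fst p) (snd p))"
  "continuous_on (UNIV \<times> {-pi..pi}) (\<lambda>p. v'_sol (fst p) (snd p))"
  unfolding w_sol_def v_sol_def v'_sol_def W_poly_def Wr_poly_def Wy_poly_def Wyr_poly_def Wyy_poly_def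
  by (intro continuous_intros y_Y_sol_continuous; simp)+

lemma y_sol_boundary: "y_sol t pi = 0" "y_sol t (-pi) = 1"
  by (simp_all add: y_sol_def D_sol_def)

lemma w_sol_boundary: "w_sol t pi = 0" "w_sol t (-pi) = 0"
  by (simp_all add: w_sol_def W_poly_def y_sol_boundary)

text \<open>\<open>w_sol\<close> is a multiple of the derivative of \<open>B_sol\<close>, whose
  factor \<open>(1 + z / pi) * (1 - z / pi)\<close> vanishes at both ends.\<close>

lemma w_sol_mean: "(LBINT z:{-pi..pi}. w_sol t z) = 0"
proof -
  have "continuous_on {-pi..pi} (w_sol t)"
    using has_field_derivative_at_within[OF w_sol_deriv] by (intro DERIV_continuous_on)
  then have "B_sol t pi = B_sol t (-pi) + (LBINT z:{-pi..pi}. - 6 / pi * w_sol t z)"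
    by (intro integral_of_C1 continuous_on_mult continuous_on_const has_field_derivative_at_within[OF B_sol_deriv]) auto
  then show ?thesis unfolding set_integral_mult_right by (simp add: B_sol_def)
qed

lemma v_sol_is_global_solution:
  "is_global_solution (\<lambda>z. v_sol 0 (zper z)) (\<lambda>t z. v_sol t (zper z))"
\<comment> \<open>With this \<open>g\<close> the equation becomes an identity; its content moves
  into the derivative of \<open>speed * v_sol\<close>.\<close>
proof (rule classical_solution_is_global_solution[where w = w_sol and v' = v'_sol
      and g = "\<lambda>t z. w_sol t z - v'_sol t z"])
  show "continuous_on (UNIV \<times> {-pi..pi}) (\<lambda>p. w_sol (fst p) (snd p) - v'_sol (fst p) (snd p))"
    by (intro continuous_on_diff w_v_sol_continuous)
  show "(w_sol t has_real_derivative v_sol t z) (at z within {-pi..pi})" if "z \<in> {-pi..pi}" for t z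
    by (rule has_field_derivative_at_within[OF w_sol_deriv[OF that]])
  show "((\<lambda>z. speed z * v_sol t z) has_real_derivative w_sol t z - v'_sol t z) (at z within {-pi..pi})"
    if "z \<in> {-pi..pi}" for t z
    by (rule speed_v_sol_deriv[OF that])
  show "((\<lambda>t. v_sol t z) has_real_derivative v'_sol t z) (at t)" if "z \<in> {-pi..pi}" for t z
    by (rule v_sol_deriv_t[OF that])
qed (simp_all add: w_v_sol_continuous w_sol_mean w_sol_boundary)

text \<open>Evaluating \<open>w\<close> where \<open>y = 1 / 2\<close>, at distance of order \<open>1 / T\<close> from \<open>- \<pi>\<close>, shows that
  \<open>v\<close> has mass of order one on an interval of length \<open>O(1 / T)\<close>.\<close>

lemma v_sol_lower_bound:
  assumes "0 \<le> t"
  shows "3 / 16 * sqrt (15 / (2 * pi)) * exp (pi * t / 6) \<le> L2_norm (\<lambda>z. v_sol t (zper z))"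
proof -
  define T where "T = T_sol t"
  have T: "15 \<le> T" using assms by (simp add: T_def T_sol_def)
  define b where "b = 2 * pi / (1 + T) - pi"
  have b: "b \<in> {-pi..pi}" using T by (auto simp: b_def field_simps)
  have pb: "pi - b = T * (pi + b)" using T by (simp add: b_def field_simps)
  have Tb: "0 < T * (pi + b)" using T by (simp add: b_def)
  have y: "y_sol t b = 1 / 2"
    unfolding y_sol_def D_sol_def T_def[symmetric] pb using Tb by (simp add: field_simps)
  define r where "r = 1 + b / pi"
  have r: "r = 2 / (1 + T)" by (simp add: r_def b_def diff_divide_distrib)
  \<comment> \<open>The factor 15 in \<open>T_sol\<close>, a shift of the time origin, is chosen for
    this bound: with \<open>r\<close> at most \<open>1 / 8\<close>, the term
    \<open>3 / 2 * r\<close> takes away at most half of \<open>3 / 8\<close>.\<close>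
  have r': "0 \<le> r" "r \<le> 1 / 8" unfolding r using T by (simp_all add: field_simps)
  have "w_sol t b = 3 / 4 * (1 / 2 - 2 * r + r\<^sup>2)"
    unfolding w_sol_def y r_def[symmetric] W_poly_def by (simp add: power2_eq_square algebra_simps)
  also have "\<dots> = 3 / 8 - 3 / 2 * r + 3 / 4 * r\<^sup>2" by (simp add: algebra_simps)
  finally have wb: "3 / 16 \<le> w_sol t b" using r' zero_le_power2[of r] by linarith
  have cv: "continuous_on {-pi..pi} (v_sol t)"
    by (rule continuous_on_time_slice[OF w_v_sol_continuous(2)])
  note vL2 = L2_per_zper[OF cv]
  have "w_sol t b = w_sol t (-pi) + (LBINT z:{-pi..b}. v_sol t z)"
    by (rule integral_of_C1[OF has_field_derivative_at_within[OF w_sol_deriv] cv b])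
  also have "(LBINT z:{-pi..b}. v_sol t z) = (LBINT z:{-pi..b}. v_sol t (zper z))"
    by (rule set_integral_cong_period[OF _ b]) (simp add: zper_eq)
  finally have w: "w_sol t b = (LBINT z:{-pi..b}. v_sol t (zper z))" by (simp add: w_sol_boundary)
  define V where "V z = v_sol t (zper z)" for z
  have [measurable]: "V \<in> borel_measurable borel"
    using L2_perD(1)[OF vL2] by (simp add: V_def[abs_def])
  have eq: "w_sol t b = (\<integral>z. indicator {-pi..b} z * (indicator {-pi..pi} z * V z) \<partial>lborel)"
    unfolding w set_lebesgue_integral_def V_def using b
    by (intro Bochner_Integration.integral_cong) (auto simp: indicator_def)
  have ind: "(indicator {-pi..b} z)\<^sup>2 = (indicator {-pi..b} z :: real)" for z
    by (simp add: indicator_def)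
  have "\<bar>w_sol t b\<bar> \<le> sqrt (\<integral>z. (indicator {-pi..b} z)\<^sup>2 \<partial>lborel)
      * sqrt (\<integral>z. (indicator {-pi..pi} z * V z)\<^sup>2 \<partial>lborel)"
    unfolding eq
  proof (rule Cauchy_Schwarz_integral)
    show "integrable lborel (\<lambda>z. (indicator {-pi..b} z :: real)\<^sup>2)" unfolding ind by (intro integrable_real_indicator) (auto simp: emeasure_lborel_Icc_eq)
    show "integrable lborel (\<lambda>z. (indicator {-pi..pi} z * V z)\<^sup>2)"
      using L2_per_square_integrable[OF vL2] by (simp add: V_def)
  qed measurable
  then have "\<bar>w_sol t b\<bar> \<le> sqrt (pi + b) * L2_norm V"
    using b by (simp add: L2_norm_def set_lebesgue_integral_def indicator_mult_square ind add.commute)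
  then have "3 / 16 \<le> sqrt (pi + b) * L2_norm V" using wb by linarith
  also have "\<dots> \<le> sqrt (2 * pi / T) * L2_norm V"
    using T by (intro mult_right_mono real_sqrt_le_mono) (auto simp: b_def field_simps)
  finally have "sqrt (T / (2 * pi)) * (3 / 16) \<le> sqrt (T / (2 * pi)) * (sqrt (2 * pi / T) * L2_norm V)"
    using T by (intro mult_left_mono) auto
  also have "\<dots> = sqrt (T / (2 * pi) * (2 * pi / T)) * L2_norm V"
    by (simp only: real_sqrt_mult mult.assoc)
  also have "\<dots> = L2_norm V" using T by simp
  finally have "sqrt (T / (2 * pi)) * (3 / 16) \<le> L2_norm V" .
  moreover have "sqrt (T / (2 * pi)) = sqrt (15 / (2 * pi)) * exp (pi * t / 6)"
  proof -
    have "exp (pi * t / 3) = (exp (pi * t / 6))\<^sup>2"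
      by (simp add: power2_eq_square flip: exp_add)
    then have "T / (2 * pi) = 15 / (2 * pi) * (exp (pi * t / 6))\<^sup>2" by (simp add: T_def T_sol_def)
    then have "sqrt (T / (2 * pi)) = sqrt (15 / (2 * pi)) * sqrt ((exp (pi * t / 6))\<^sup>2)"
      by (simp only: real_sqrt_mult)
    then show ?thesis by simp
  qed
  ultimately show ?thesis by (simp add: V_def[abs_def] mult.commute)
qed

theorem lemma7:
  shows "\<exists>v\<^sub>0 C. v\<^sub>0 \<in> X1_per \<and> \<not> (AE z in lborel. v\<^sub>0 z = 0) \<and> C > 0 \<and>
    (\<exists>v. is_global_solution v\<^sub>0 v \<and>
         (\<forall>w. is_global_solution v\<^sub>0 w \<longrightarrow> (\<forall>t. AE z in lborel. w t z = v t z)) \<and>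
         (\<forall>t>0. L2_norm (v t) \<ge> C * L2_norm v\<^sub>0 * exp (pi * t / 6)))"
proof -
  define v where "v t z = v_sol t (zper z)" for t z
  define \<kappa> where "\<kappa> = 3 / 16 * sqrt (15 / (2 * pi))"
  have \<kappa>: "0 < \<kappa>" by (simp add: \<kappa>_def)
  have sol: "is_global_solution (v 0) v"
    using v_sol_is_global_solution by (simp add: v_def[abs_def])
  have bound: "\<kappa> * exp (pi * t / 6) \<le> L2_norm (v t)" if "0 \<le> t" for t
    using v_sol_lower_bound[OF that] by (simp add: \<kappa>_def v_def[abs_def])
  \<comment> \<open>The growth bound at time 0 already shows that the initial value is nonzero, so
    \<open>\<kappa> / L2_norm (v 0)\<close> can serve as the constant \<open>C\<close>.\<close>
  have pos: "0 < L2_norm (v 0)" using bound[of 0] \<kappa> by simp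
  have X1: "v 0 \<in> X1_per" using sol by (auto simp: is_global_solution_def continuous_X1_def)
  have "\<not> (AE z in lborel. v 0 z = 0)"
  proof
    assume "AE z in lborel. v 0 z = 0"
    then have "L2_norm (v 0) = L2_norm (\<lambda>_. 0)"
      using L2_perD(1)[OF X1_perD(2)[OF X1]] by (intro L2_norm_cong_AE) auto
    then show False using pos by (simp add: L2_norm_def)
  qed
  moreover have "\<kappa> / L2_norm (v 0) * L2_norm (v 0) * exp (pi * t / 6) \<le> L2_norm (v t)" if "0 < t" for t
    using bound[of t] that pos by simp
  moreover have "\<forall>w. is_global_solution (v 0) w \<longrightarrow> (\<forall>t. AE z in lborel. w t z = v t z)"
    using global_solution_unique[OF _ sol] by blast
  ultimately show ?thesis
    using X1 sol \<kappa> pos by (intro exI[of _ "v 0"] exI[of _ "\<kappa> / L2_norm (v 0)"] conjI exI[of _ v]) auto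
qed

end
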